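(* Let $n\ge 2$, let $(X,x)$ be a path-connected based space, and let $K\subseteq\mathbb{N}$ be a non-empty (finite or infinite) set. Let $\mathscr{R}=\{R_k\mid k\in K\}$ and $\mathscr{S}=\{S_k\mid k\in K\}$ be $n$-domains over $K$ and let $\{f_k\}_{k\in K}$ be a $K$-sequence in $\Omega^n(X,x)$. Then $\prod_{\mathscr{R}}f_k\simeq\prod_{\mathscr{S}}f_k$ by a homotopy with image in $\bigcup_{k\in K}\mathrm{Im}(f_k)$. Moreover, if there is a finite set $F\subseteq K$ such that $R_k=S_k$ for all $k\in F$ and $I^n\setminus\bigcup_{k\in F}R_k$ is path connected, then the homotopy may be chosen to be the constant homotopy on $\bigcup_{k\in F}R_k$.
   Context: $I=[0,1]$, and $\Omega^n(X,x)$ is the space of maps (continuous functions) of pairs $(I^n,\partial I^n)\to(X,x)$. An $n$-cube is a subset of $I^n$ of the form $\prod_{i=1}^n[a_i,b_i]$ with $a_i<b_i$. For $n$-cubes $R,R'$, $L_{R,R'}:R\to R'$ is the canonical homeomorphism that is increasing and linear (affine) in each coordinate. An $n$-domain over $K\subseteq\mathbb{N}$ is an indexed collection $\mathscr{R}=\{R_k\mid k\in K\}$ of $n$-cubes in $I^n$ with pairwise disjoint interiors. A family $\{f_k\}_{k\in K}$ in $\Omega^n(X,x)$ is a $K$-sequence if either $K$ is finite, or $K$ is infinite and the family is null at $x$, i.e. every neighborhood of $x$ contains $\mathrm{Im}(f_k)$ for all but finitely many $k\in K$. The $\mathscr{R}$-concatenation $\prod_{\mathscr{R}}f_k\in\Omega^n(X,x)$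 of a $K$-sequence is the map whose restriction to $R_k$ is $f_k\circ L_{R_k,I^n}$ for each $k\in K$ and which sends $I^n\setminus\bigcup_{k\in K}R_k$ to $x$. The relation $\simeq$ between elements of $\Omega^n(X,x)$ denotes homotopy relative to $\partial I^n$. A homotopy $H:I^n\times I\to X$ is the constant homotopy on $A\subseteq I^n$ if $H(a,t)=H(a,0)$ for all $a\in A$, $t\in I$. *)

theory Defs
  imports "HOL-Analysis.Analysis"
begin

abbreviation icube :: "(real^'n) set" where
  "icube \<equiv> cbox 0 1"

(* Elements of Omega^n(X,x) are total functions on real^'n; only their values on the unit cube
   matter, and nothing is required of them elsewhere. *)
definition Omega :: "'a topology \<Rightarrow> 'a \<Rightarrow> (real^'n \<Rightarrow> 'a) set" where
  "Omega X x = {f. continuous_map (top_of_set icube) X f \<and> (\<forall>p\<in>frontier icube. f p = x)}"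

definition n_cube :: "(real^'n) set \<Rightarrow> bool" where
  "n_cube R \<longleftrightarrow> R \<subseteq> icube \<and> (\<exists>a b. (\<forall>i. a $ i < b $ i) \<and> R = cbox a b)"

(* For R = cbox a b the corners a and b are recovered from the set by interval_lowerbound
   and interval_upperbound. *)
definition cube_map :: "(real^'n) set \<Rightarrow> (real^'n) set \<Rightarrow> real^'n \<Rightarrow> real^'n" where
  "cube_map R R' p =
     (let a = interval_lowerbound R; b = interval_upperbound R;
          a' = interval_lowerbound R'; b' = interval_upperbound R'
      in \<chi> i. a' $ i + (p $ i - a $ i) * ((b' $ i - a' $ i) / (b $ i - a $ i)))"

definition n_domain :: "nat set \<Rightarrow> (nat \<Rightarrow> (real^'n) set) \<Rightarrow> bool" where
  "n_domain K R \<longleftrightarrow> (\<forall>k\<in>K. n_cube (R k)) \<and> disjoint_family_on (\<lambda>k. interior (R k)) K"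

definition null_at :: "'a topology \<Rightarrow> 'a \<Rightarrow> nat set \<Rightarrow> (nat \<Rightarrow> real^'n \<Rightarrow> 'a) \<Rightarrow> bool" where
  "null_at X x K f \<longleftrightarrow> (\<forall>U. openin X U \<and> x \<in> U \<longrightarrow> finite {k\<in>K. \<not> f k ` icube \<subseteq> U})"

definition K_sequence :: "'a topology \<Rightarrow> 'a \<Rightarrow> nat set \<Rightarrow> (nat \<Rightarrow> real^'n \<Rightarrow> 'a) \<Rightarrow> bool" where
  "K_sequence X x K f \<longleftrightarrow>
     (\<forall>k\<in>K. f k \<in> Omega X x) \<and> (finite K \<or> infinite K \<and> null_at X x K f)"

(* The choice of k is immaterial: a point in two different cubes lies on the boundary of both,
   so that every choice gives the value x (lemma concatenation_on_cube). *)
definition concatenation ::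
  "'a \<Rightarrow> nat set \<Rightarrow> (nat \<Rightarrow> (real^'n) set) \<Rightarrow> (nat \<Rightarrow> real^'n \<Rightarrow> 'a) \<Rightarrow> real^'n \<Rightarrow> 'a" where
  "concatenation x K R f p =
     (if \<exists>k\<in>K. p \<in> R k
      then let k = (SOME k. k \<in> K \<and> p \<in> R k) in f k (cube_map (R k) icube p)
      else x)"

definition constant_homotopy_on :: "(real^'n) set \<Rightarrow> ((real^'n) \<times> real \<Rightarrow> 'a) \<Rightarrow> bool" where
  "constant_homotopy_on A H \<longleftrightarrow> (\<forall>p\<in>A. \<forall>t\<in>{0..1}. H (p, t) = H (p, 0))"

definition homotopy_rel_boundary ::
  "'a topology \<Rightarrow> (real^'n \<Rightarrow> 'a) \<Rightarrow> (real^'n \<Rightarrow> 'a) \<Rightarrow> ((real^'n) \<times> real \<Rightarrow> 'a) \<Rightarrow> bool" where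
  "homotopy_rel_boundary X f g H \<longleftrightarrow>
     continuous_map (prod_topology (top_of_set icube) (top_of_set {0..1})) X H \<and>
     (\<forall>p\<in>icube. H (p, 0) = f p \<and> H (p, 1) = g p) \<and>
     constant_homotopy_on (frontier icube) H"

lemma cube_map_cbox:
  fixes a b a' b' :: "real^'n"
  assumes "\<forall>i. a $ i < b $ i" "\<forall>i. a' $ i < b' $ i"
  shows "cube_map (cbox a b) (cbox a' b') p =
    (\<chi> i. a' $ i + (p $ i - a $ i) * ((b' $ i - a' $ i) / (b $ i - a $ i)))"
proof -
  have "\<forall>i\<in>Basis. a \<bullet> i \<le> b \<bullet> i" "\<forall>i\<in>Basis. a' \<bullet> i \<le> b' \<bullet> i"
    using assms by (auto simp: Basis_vec_def inner_axis intro: less_imp_le)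
  then show ?thesis by (simp add: cube_map_def Let_def)
qed

lemma frontier_cbox_vec:
  fixes a b :: "real^'n"
  shows "p \<in> frontier (cbox a b) \<longleftrightarrow> p \<in> cbox a b \<and> (\<exists>i. p $ i = a $ i \<or> p $ i = b $ i)"
  by (auto simp: frontier_cbox mem_box_cart) (metis order_less_le)+

lemma concatenation_on_cube:
  fixes R :: "nat \<Rightarrow> (real^'n) set"
  assumes R: "n_domain K R" and f: "\<forall>k\<in>K. f k \<in> Omega X x" and k: "k \<in> K" "p \<in> R k"
  shows "concatenation x K R f p = f k (cube_map (R k) icube p)"
proof -
  define j where "j = (SOME k. k \<in> K \<and> p \<in> R k)"
  have j: "j \<in> K" "p \<in> R j"
    using someI[of "\<lambda>k. k \<in> K \<and> p \<in> R k" k] k by (auto simp: j_def)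
  have box: "\<exists>a b. (\<forall>i. a $ i < b $ i) \<and> R m = cbox a b" if "m \<in> K" for m
    using R that by (auto simp: n_domain_def n_cube_def)
  have not_int: "p \<notin> interior (R m)" if m: "m \<in> K" "l \<in> K" "m \<noteq> l" "p \<in> R l" for m l
  proof
    assume "p \<in> interior (R m)"
    obtain a b where ab: "\<forall>i. a $ i < b $ i" "R l = cbox a b" using box[OF m(2)] by blast
    have "box a b \<noteq> {}" using ab(1) by (auto simp: interval_ne_empty_cart)
    then have "p \<in> closure (interior (R l))"
      using m(4) ab(2) by (simp add: closure_box)
    with \<open>p \<in> interior (R m)\<close> have "interior (R m) \<inter> interior (R l) \<noteq> {}"
      by (meson disjoint_iff open_interior open_Int_closure_eq_empty)
    then show False using R m by (auto simp: n_domain_def disjoint_family_on_def)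
  qed
  have val: "f m (cube_map (R m) icube p) = x" if m: "m \<in> K" "l \<in> K" "m \<noteq> l" "p \<in> R m" "p \<in> R l" for m l
  proof -
    obtain a b where ab: "\<forall>i. a $ i < b $ i" "R m = cbox a b" using box[OF m(1)] by blast
    have "p \<in> frontier (cbox a b)"
      using not_int[OF m(1,2,3,5)] m(4) ab(2) by (simp add: frontier_def)
    then obtain i where p: "p \<in> cbox a b" and i: "p $ i = a $ i \<or> p $ i = b $ i"
      by (auto simp: frontier_cbox_vec)
    let ?q = "cube_map (R m) icube p"
    have q: "?q = (\<chi> i. (p $ i - a $ i) / (b $ i - a $ i))"
      using cube_map_cbox[OF ab(1), of 0 1 p] ab(2) by simp
    have "?q \<in> icube"
      using p ab(1) by (auto simp: q mem_box_cart divide_simps less_imp_le)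
    moreover have "?q $ i = 0 \<or> ?q $ i = 1"
      using i ab(1) by (auto simp: q)
    ultimately have "?q \<in> frontier icube" by (auto simp: frontier_cbox_vec)
    then show ?thesis using f m(1) by (auto simp: Omega_def)
  qed
  have "f j (cube_map (R j) icube p) = f k (cube_map (R k) icube p)"
    using val[of j k] val[of k j] j k by (cases "j = k") auto
  then show ?thesis using k by (auto simp: concatenation_def Let_def j_def)
qed

end

theory Submission
  imports Defs
begin

text \<open>
  The homotopy moves the cubes and leaves the maps alone. Suppose that every \<open>R k\<close> travels to \<open>S k\<close>
  through boxes whose interiors stay pairwise disjoint at each time. Concatenating the \<open>f k\<close> over the
  boxes at time \<open>t\<close> gives a homotopy with values in the images of the \<open>f k\<close> (\<open>isotopy_imp_homotopy\<close>).
  Its continuity needs each box to move continuously, but no uniformity in \<open>k\<close>: maps that differ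
  from \<open>x\<close> on pairwise disjoint sets and form a null family always glue (\<open>continuous_map_join\<close>). The
  theorem thus becomes a statement about boxes: two arrangements of countably many disjoint open boxes
  can be deformed into each other, leaving finitely many of them fixed
  (\<open>arrangements_isotopic_rel\<close>).

  Finitely many boxes in a connected open set \<open>W\<close> of dimension at least \<open>2\<close> can be moved anywhere:
  shrink them to tiny cubes around points and move the points one at a time, along paths that avoid
  the other points; removing finitely many points does not disconnect \<open>W\<close>
  (\<open>finite_arrangements_isotopic\<close>). A moving box carries along every box inside it
  (\<open>isotopic_rel_carry\<close>), so infinitely many boxes can be moved in finitely many groups. Since the
  complement of finitely many boxes is divided into finitely many cells (\<open>subdivision\<close>), and every
  other box can be shrunk into a cell that it meets, all other boxes can be gathered in one place
  (\<open>gather\<close>).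

  Inside a single box, infinitely many boxes are sorted one after the other. Fix boxes \<open>Z 0\<close>, \<open>Z 1\<close>, ...,
  each containing the next, and \<open>T m\<close> inside \<open>Z m\<close> but off \<open>Z (Suc m)\<close>. Stage \<open>m\<close> takes place inside \<open>Z m\<close>: it
  moves box \<open>m\<close> onto \<open>T m\<close> and all later boxes into \<open>Z (Suc m)\<close>. Box \<open>k\<close> rests after stage \<open>k\<close>, so the
  concatenation of all the stages is continuous for each box, including at its final time
  (\<open>isotopic_rel_limit\<close>). Hence every arrangement in \<open>Z 0\<close> can be deformed into \<open>T\<close>
  (\<open>isotopic_nested_boxes\<close>), and any two arrangements into each other.

  If the boxes with index in \<open>F\<close> have to rest, then the other boxes of both arrangements are first
  gathered in the same box off those resting ones. This uses that the complement of the resting boxes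
  in the open unit cube is connected, which follows from the hypothesis on the closed cube by pulling
  paths off its boundary (\<open>path_connected_interior_diff\<close>).
\<close>

section \<open>Boxes and arrangements\<close>

text \<open>
  A box is encoded by its pair of extreme corners, a point of a normed vector space: a moving box is
  then a path in the sense of the library.
\<close>

type_synonym 'n corners = "(real^'n) \<times> (real^'n)"

definition open_box :: "'n::finite corners \<Rightarrow> (real^'n) set" where
  "open_box c = box (fst c) (snd c)"

definition closed_box :: "'n::finite corners \<Rightarrow> (real^'n) set" where
  "closed_box c = cbox (fst c) (snd c)"

text \<open>
  Disjointness of the open boxes is disjointness of the interiors of the closed ones.
\<close>

definition arrangement :: "(real^'n) set \<Rightarrow> 'k set \<Rightarrow> ('k \<Rightarrow> 'n::finite corners) \<Rightarrow> bool" where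
  "arrangement W K c \<longleftrightarrow>
     (\<forall>k\<in>K. open_box (c k) \<noteq> {} \<and> open_box (c k) \<subseteq> W) \<and>
     disjoint_family_on (\<lambda>k. open_box (c k)) K"

lemma mem_open_box: "p \<in> open_box c \<longleftrightarrow> (\<forall>i. fst c $ i < p $ i \<and> p $ i < snd c $ i)"
  by (simp add: open_box_def mem_box_cart)

lemma mem_closed_box: "p \<in> closed_box c \<longleftrightarrow> (\<forall>i. fst c $ i \<le> p $ i \<and> p $ i \<le> snd c $ i)"
  by (simp add: closed_box_def mem_box_cart)

lemma open_box_nonempty: "open_box c \<noteq> {} \<longleftrightarrow> (\<forall>i. fst c $ i < snd c $ i)"
  by (simp add: open_box_def interval_ne_empty_cart)

lemma open_open_box [simp]: "open (open_box c)"
  by (simp add: open_box_def open_box)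

lemma interior_closed_box [simp]: "interior (closed_box c) = open_box c"
  by (simp add: open_box_def closed_box_def)

lemma closure_open_box: "open_box c \<noteq> {} \<Longrightarrow> closure (open_box c) = closed_box c"
  by (simp add: open_box_def closed_box_def closure_box)

lemma connected_open_box: "connected (open_box c)"
  by (simp add: open_box_def convex_connected)

lemma open_box_subset_iff:
  assumes "open_box c \<noteq> {}"
  shows "open_box c \<subseteq> open_box d \<longleftrightarrow> (\<forall>i. fst d $ i \<le> fst c $ i \<and> snd c $ i \<le> snd d $ i)"
  using assms unfolding open_box_nonempty
  by (force simp: open_box_def subset_box Basis_vec_def inner_axis)

lemma open_box_in_open:
  assumes "open U" "U \<noteq> {}"
  obtains c :: "'n::finite corners" where "open_box c \<noteq> {}" "open_box c \<subseteq> U"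
proof -
  from assms obtain p where "p \<in> U" by blast
  then obtain a b where "box a b \<subseteq> U" "p \<in> box a b"
    using open_contains_box[OF assms(1)] by metis
  then show thesis using that[of "(a, b)"] by (auto simp: open_box_def)
qed

lemma open_disjoint_closed_box:
  assumes "open U" "U \<inter> open_box c = {}" "open_box c \<noteq> {}"
  shows "U \<inter> closed_box c = {}"
  using assms open_Int_closure_eq_empty[of U "open_box c"] by (simp add: closure_open_box)

lemma arrangementD:
  assumes "arrangement W K c" "k \<in> K"
  shows "open_box (c k) \<noteq> {}" "open_box (c k) \<subseteq> W"
  using assms by (auto simp: arrangement_def)

lemma arrangement_disjoint:
  assumes "arrangement W K c" "k \<in> K" "l \<in> K" "k \<noteq> l"
  shows "open_box (c k) \<inter> open_box (c l) = {}"
  using assms by (auto simp: arrangement_def disjoint_family_on_def)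

lemma arrangementI:
  assumes "\<And>k. k \<in> K \<Longrightarrow> open_box (c k) \<noteq> {}" "\<And>k. k \<in> K \<Longrightarrow> open_box (c k) \<subseteq> W"
    and "\<And>k l. k \<in> K \<Longrightarrow> l \<in> K \<Longrightarrow> k \<noteq> l \<Longrightarrow> open_box (c k) \<inter> open_box (c l) = {}"
  shows "arrangement W K c"
  using assms by (auto simp: arrangement_def disjoint_family_on_def)

lemma arrangement_subset: "arrangement W K c \<Longrightarrow> L \<subseteq> K \<Longrightarrow> arrangement W L c"
  unfolding arrangement_def by (meson disjoint_family_on_mono subsetD)

lemma arrangement_mono: "arrangement W K c \<Longrightarrow> W \<subseteq> W' \<Longrightarrow> arrangement W' K c"
  by (auto simp: arrangement_def)

lemma arrangement_cong:
  "(\<And>k. k \<in> K \<Longrightarrow> c k = d k) \<Longrightarrow> arrangement W K c \<longleftrightarrow> arrangement W K d"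
  by (simp add: arrangement_def disjoint_family_on_def)

lemma arrangement_shrink:
  assumes "arrangement W K c" "\<And>k. k \<in> K \<Longrightarrow> open_box (d k) \<noteq> {}"
    and "\<And>k. k \<in> K \<Longrightarrow> open_box (d k) \<subseteq> open_box (c k)"
  shows "arrangement W K d"
proof (rule arrangementI)
  fix k l assume kl: "k \<in> K" "l \<in> K" "k \<noteq> l"
  show "open_box (d k) \<inter> open_box (d l) = {}"
    using arrangement_disjoint[OF assms(1) kl] assms(3)[OF kl(1)] assms(3)[OF kl(2)] by blast
next
  fix k assume "k \<in> K"
  then show "open_box (d k) \<noteq> {}" "open_box (d k) \<subseteq> W"
    using assms(2,3)[of k] arrangementD(2)[OF assms(1), of k] by auto
qed

section \<open>Isotopies of arrangements\<close>

text \<open>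
  Each box moves continuously on its own: there is no condition relating the speeds of different
  boxes. This is what makes infinitely many simultaneous motions easy to build.
\<close>

definition isotopy ::
  "'k set \<Rightarrow> (real^'n) set \<Rightarrow> 'k set \<Rightarrow> ('k \<Rightarrow> 'n::finite corners) \<Rightarrow> ('k \<Rightarrow> 'n corners) \<Rightarrow>
   ('k \<Rightarrow> real \<Rightarrow> 'n corners) \<Rightarrow> bool" where
  "isotopy F W K c d g \<longleftrightarrow>
     (\<forall>k\<in>K. path (g k) \<and> g k 0 = c k \<and> g k 1 = d k) \<and>
     (\<forall>t\<in>{0..1}. arrangement W K (\<lambda>k. g k t)) \<and>
     (\<forall>k\<in>F \<inter> K. \<forall>t\<in>{0..1}. g k t = c k)"

definition isotopic_rel ::
  "'k set \<Rightarrow> (real^'n) set \<Rightarrow> 'k set \<Rightarrow> ('k \<Rightarrow> 'n::finite corners) \<Rightarrow> ('k \<Rightarrow> 'n corners) \<Rightarrow> bool" where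
  "isotopic_rel F W K c d \<longleftrightarrow> (\<exists>g. isotopy F W K c d g)"

lemma isotopyD:
  assumes "isotopy F W K c d g"
  shows "\<And>k. k \<in> K \<Longrightarrow> path (g k)" "\<And>k. k \<in> K \<Longrightarrow> g k 0 = c k" "\<And>k. k \<in> K \<Longrightarrow> g k 1 = d k"
    "\<And>t. t \<in> {0..1} \<Longrightarrow> arrangement W K (\<lambda>k. g k t)"
    "\<And>k t. k \<in> F \<Longrightarrow> k \<in> K \<Longrightarrow> t \<in> {0..1} \<Longrightarrow> g k t = c k"
  using assms by (simp_all add: isotopy_def)

lemma isotopic_relI:
  assumes "\<And>k. k \<in> K \<Longrightarrow> path (g k)" "\<And>k. k \<in> K \<Longrightarrow> g k 0 = c k" "\<And>k. k \<in> K \<Longrightarrow> g k 1 = d k"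
    "\<And>t. t \<in> {0..1} \<Longrightarrow> arrangement W K (\<lambda>k. g k t)"
    "\<And>k t. k \<in> F \<Longrightarrow> k \<in> K \<Longrightarrow> t \<in> {0..1} \<Longrightarrow> g k t = c k"
  shows "isotopic_rel F W K c d"
  unfolding isotopic_rel_def isotopy_def
  by (rule exI[of _ g], intro conjI ballI) (simp_all add: assms)

lemma isotopic_rel_arrangement:
  assumes "isotopic_rel F W K c d"
  shows "arrangement W K c" "arrangement W K d"
proof -
  obtain g where "isotopy F W K c d g"
    using assms by (auto simp: isotopic_rel_def)
  note g = isotopyD[OF this]
  show "arrangement W K c" "arrangement W K d"
    using g(2,3) g(4)[of 0] g(4)[of 1] arrangement_cong[of K "\<lambda>k. g k 0" c W]
      arrangement_cong[of K "\<lambda>k. g k 1" d W]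
    by auto
qed

lemma isotopic_rel_eq:
  assumes "arrangement W K c" "\<And>k. k \<in> K \<Longrightarrow> c k = d k"
  shows "isotopic_rel F W K c d"
  by (rule isotopic_relI[where g = "\<lambda>k _. c k"]) (use assms in \<open>auto simp: path_def\<close>)

lemma isotopic_rel_sym:
  assumes "isotopic_rel F W K c d"
  shows "isotopic_rel F W K d c"
proof -
  obtain g where "isotopy F W K c d g"
    using assms by (auto simp: isotopic_rel_def)
  note g = isotopyD[OF this]
  show ?thesis
  proof (rule isotopic_relI[where g = "\<lambda>k. reversepath (g k)"])
    fix k t assume "k \<in> F" "k \<in> K" "t \<in> {0..1::real}"
    then show "reversepath (g k) t = d k"
      using g(5)[of k "1 - t"] g(5)[of k 1] g(3)[of k] by (auto simp: reversepath_def)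
  next
    fix t :: real assume "t \<in> {0..1}"
    then show "arrangement W K (\<lambda>k. reversepath (g k) t)"
      using g(4)[of "1 - t"] by (simp add: reversepath_def)
  next
    fix k assume k: "k \<in> K"
    show "path (reversepath (g k))" using g(1)[OF k] by (simp only: path_reversepath)
    show "reversepath (g k) 0 = d k" "reversepath (g k) 1 = c k"
      using g(2,3)[OF k] by (simp_all add: reversepath_def)
  qed
qed

lemma isotopic_rel_trans [trans]:
  assumes "isotopic_rel F W K c d" "isotopic_rel F W K d e"
  shows "isotopic_rel F W K c e"
proof -
  obtain g where "isotopy F W K c d g"
    using assms(1) by (auto simp: isotopic_rel_def)
  note g = isotopyD[OF this]
  obtain h where "isotopy F W K d e h"
    using assms(2) by (auto simp: isotopic_rel_def)
  note h = isotopyD[OF this]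
  show ?thesis
  proof (rule isotopic_relI[where g = "\<lambda>k. g k +++ h k"])
    fix t :: real assume "t \<in> {0..1}"
    then show "arrangement W K (\<lambda>k. (g k +++ h k) t)"
      using g(4)[of "2 * t"] h(4)[of "2 * t - 1"] by (cases "t \<le> 1/2") (auto simp: joinpaths_def)
  next
    fix k and t :: real assume kt: "k \<in> F" "k \<in> K" "t \<in> {0..1}"
    then have "d k = c k" using g(5)[of k 1] g(3)[of k] by simp
    then show "(g k +++ h k) t = c k"
      using g(5)[of k "2 * t"] h(5)[of k "2 * t - 1"] kt by (auto simp: joinpaths_def)
  next
    fix k assume k: "k \<in> K"
    show "path (g k +++ h k)"
      using g(1,3) h(1,2) k by (intro path_join_imp) (auto simp: pathstart_def pathfinish_def)
    show "(g k +++ h k) 0 = c k" "(g k +++ h k) 1 = e k"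
      using g(2) h(3) k by (auto simp: joinpaths_def)
  qed
qed

lemma isotopic_rel_mono:
  assumes "isotopic_rel F W K c d" "W \<subseteq> W'"
  shows "isotopic_rel F W' K c d"
proof -
  obtain g where "isotopy F W K c d g"
    using assms(1) by (auto simp: isotopic_rel_def)
  note g = isotopyD[OF this]
  show ?thesis
    by (rule isotopic_relI[where g = g]) (simp_all add: g arrangement_mono[OF g(4) assms(2)])
qed

text \<open>
  Boxes that rest outside the region where the motion takes place can be added to it.
\<close>

lemma isotopic_rel_union:
  assumes iso: "isotopic_rel {} V (K - F) c d" and c: "arrangement W K c"
    and V: "V \<subseteq> W" "\<And>k. k \<in> F \<inter> K \<Longrightarrow> open_box (c k) \<inter> V = {}"
    and eq: "\<And>k. k \<in> F \<inter> K \<Longrightarrow> c k = d k"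
  shows "isotopic_rel F W K c d"
proof -
  obtain g where "isotopy {} V (K - F) c d g"
    using iso by (auto simp: isotopic_rel_def)
  note g = isotopyD[OF this]
  define h where "h k = (if k \<in> F then (\<lambda>_. c k) else g k)" for k
  have "arrangement W K (\<lambda>k. h k t)" if t: "t \<in> {0..1}" for t
  proof (rule arrangementI)
    fix k l assume kl: "k \<in> K" "l \<in> K" "k \<noteq> l"
    show "open_box (h k t) \<inter> open_box (h l t) = {}"
      using arrangement_disjoint[OF c kl] arrangement_disjoint[OF g(4)[OF t], of k l] kl
        arrangementD(2)[OF g(4)[OF t], of k] arrangementD(2)[OF g(4)[OF t], of l] V(2)[of k] V(2)[of l]
      by (auto simp: h_def)
  next
    fix k assume "k \<in> K"
    then show "open_box (h k t) \<noteq> {}" "open_box (h k t) \<subseteq> W"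
      using arrangementD[OF c, of k] arrangementD[OF g(4)[OF t], of k] V(1) by (auto simp: h_def)
  qed
  then show ?thesis
    using g(1-3) eq by (intro isotopic_relI[where g = h]) (auto simp: h_def path_def)
qed

text \<open>
  Moving both corners linearly keeps each box inside its original position, so the boxes cannot
  collide.
\<close>

lemma isotopic_rel_shrink:
  assumes c: "arrangement W K c"
    and d: "\<And>k. k \<in> K \<Longrightarrow> open_box (d k) \<noteq> {}" "\<And>k. k \<in> K \<Longrightarrow> open_box (d k) \<subseteq> open_box (c k)"
  shows "isotopic_rel {} W K c d"
proof -
  define g where "g k t = (1 - t) *\<^sub>R c k + t *\<^sub>R d k" for k and t :: real
  have le: "fst (c k) $ i \<le> fst (d k) $ i" "snd (d k) $ i \<le> snd (c k) $ i"
    and less: "fst (c k) $ i < snd (c k) $ i" "fst (d k) $ i < snd (d k) $ i" if "k \<in> K" for k i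
    using d(2)[OF that] arrangementD(1)[OF c that] d(1)[OF that]
    by (simp_all add: open_box_subset_iff[OF d(1)[OF that]] open_box_nonempty)
  have ne: "open_box (g k t) \<noteq> {}" if "k \<in> K" "t \<in> {0..1}" for k t
    unfolding open_box_nonempty
  proof
    fix i
    have "(1 - t) * fst (c k) $ i + t * fst (d k) $ i < (1 - t) * snd (c k) $ i + t * snd (d k) $ i"
    proof (cases "t = 0")
      case False
      then show ?thesis using less[of k i] that
        by (intro add_le_less_mono mult_left_mono mult_strict_left_mono) auto
    qed (use less[of k i] that in auto)
    then show "fst (g k t) $ i < snd (g k t) $ i" by (simp add: g_def)
  qed
  moreover have "open_box (g k t) \<subseteq> open_box (c k)" if "k \<in> K" "t \<in> {0..1}" for k t
  proof -
    have "t * fst (c k) $ i \<le> t * fst (d k) $ i" "t * snd (d k) $ i \<le> t * snd (c k) $ i" for i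
      using le[of k i] that by (auto intro: mult_left_mono)
    then show ?thesis
      by (subst open_box_subset_iff[OF ne[OF that]]) (auto simp: g_def algebra_simps)
  qed
  ultimately have "arrangement W K (\<lambda>k. g k t)" if "t \<in> {0..1}" for t
    using that by (intro arrangement_shrink[OF c]) auto
  moreover have "path (g k)" for k
    unfolding path_def g_def by (intro continuous_intros)
  ultimately show ?thesis
    by (intro isotopic_relI[where g = g]) (auto simp: g_def)
qed

section \<open>Boxes carried by boxes\<close>

text \<open>
  Coordinates relative to a box, in which that box is the unit cube, and the inverse change of
  coordinates. For a nondegenerate box, \<open>relative_point\<close> is the canonical map onto the unit cube.
\<close>

definition relative_point :: "'n::finite corners \<Rightarrow> real^'n \<Rightarrow> real^'n" where
  "relative_point g p = (\<chi> i. (p $ i - fst g $ i) / (snd g $ i - fst g $ i))"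

definition absolute_point :: "'n::finite corners \<Rightarrow> real^'n \<Rightarrow> real^'n" where
  "absolute_point g u = (\<chi> i. fst g $ i + u $ i * (snd g $ i - fst g $ i))"

definition place :: "'n::finite corners \<Rightarrow> 'n corners \<Rightarrow> 'n corners" where
  "place g r = (absolute_point g (fst r), absolute_point g (snd r))"

definition relative_box :: "'n::finite corners \<Rightarrow> 'n corners \<Rightarrow> 'n corners" where
  "relative_box g c = (relative_point g (fst c), relative_point g (snd c))"

lemma absolute_relative:
  assumes "open_box g \<noteq> {}"
  shows "absolute_point g (relative_point g p) = p"
proof -
  have "snd g $ i - fst g $ i \<noteq> 0" for i using assms unfolding open_box_nonempty by (metis diff_gt_0_iff_gt less_irrefl)
  then show ?thesis by (simp add: absolute_point_def relative_point_def vec_eq_iff)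
qed

lemma place_relative: "open_box g \<noteq> {} \<Longrightarrow> place g (relative_box g c) = c"
  by (simp add: place_def relative_box_def absolute_relative)

lemma mem_place_iff:
  assumes "open_box g \<noteq> {}"
  shows "p \<in> open_box (place g r) \<longleftrightarrow> relative_point g p \<in> open_box r"
proof -
  have "snd g $ i - fst g $ i > 0" for i using assms by (simp add: open_box_nonempty)
  then show ?thesis
    by (simp add: mem_open_box place_def absolute_point_def relative_point_def pos_less_divide_eq
        pos_divide_less_eq less_diff_eq diff_less_eq add.commute)
qed

lemma relative_point_unit:
  assumes "open_box g \<noteq> {}"
  shows "relative_point g p \<in> open_box (0, 1) \<longleftrightarrow> p \<in> open_box g"
proof -
  have "snd g $ i - fst g $ i > 0" for i using assms by (simp add: open_box_nonempty)
  then show ?thesis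
    by (simp add: mem_open_box relative_point_def pos_less_divide_eq pos_divide_less_eq)
qed

lemma open_box_place:
  assumes "open_box g \<noteq> {}" "open_box r \<noteq> {}"
  shows "open_box (place g r) \<noteq> {}"
proof -
  have "fst g $ i < snd g $ i" "fst r $ i < snd r $ i" for i using assms by (auto simp: open_box_nonempty)
  then show ?thesis
    by (simp add: open_box_nonempty place_def absolute_point_def)
qed

lemma open_box_relative:
  assumes "open_box g \<noteq> {}" "open_box c \<noteq> {}" "open_box c \<subseteq> open_box g"
  shows "open_box (relative_box g c) \<noteq> {}" "open_box (relative_box g c) \<subseteq> open_box (0, 1)"
proof -
  have g: "snd g $ i - fst g $ i > 0" and c: "fst c $ i < snd c $ i" for i
    using assms by (auto simp: open_box_nonempty)
  have sub: "fst g $ i \<le> fst c $ i" "snd c $ i \<le> snd g $ i" for i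
    using assms(3) by (auto simp: open_box_subset_iff[OF assms(2)])
  show ne: "open_box (relative_box g c) \<noteq> {}"
    using g c by (simp add: open_box_nonempty relative_box_def relative_point_def divide_strict_right_mono)
  show "open_box (relative_box g c) \<subseteq> open_box (0, 1)"
    unfolding open_box_subset_iff[OF ne]
    using g sub by (auto simp: relative_box_def relative_point_def pos_divide_le_eq  intro: divide_nonneg_pos)
qed

text \<open>
  The boxes \<open>c k\<close> keep their coordinates relative to the moving box that contains them. Two boxes in
  the same moving box stay disjoint because their relative positions are disjoint, two boxes in
  different moving boxes because the moving boxes are. The index set \<open>K\<close> may be infinite even when \<open>J\<close>
  is finite.
\<close>

lemma isotopic_rel_carry:
  fixes K :: "'k set" and J :: "'j set"
  assumes iso: "isotopic_rel {} W J B C" and c: "arrangement W K c"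
    and i: "\<And>k. k \<in> K \<Longrightarrow> i k \<in> J" "\<And>k. k \<in> K \<Longrightarrow> open_box (c k) \<subseteq> open_box (B (i k))"
  shows "\<exists>d. isotopic_rel {} W K c d \<and> (\<forall>k\<in>K. open_box (d k) \<subseteq> open_box (C (i k)))"
proof -
  obtain g where "isotopy {} W J B C g"
    using iso by (auto simp: isotopic_rel_def)
  note g = isotopyD[OF this]
  define r where "r k = relative_box (B (i k)) (c k)" for k
  define h where "h k t = place (g (i k) t) (r k)" for k t
  have B: "open_box (B j) \<noteq> {}" if "j \<in> J" for j
    using arrangementD(1)[OF g(4)[of 0] that] g(2)[OF that] by simp
  have r: "open_box (r k) \<noteq> {}" "open_box (r k) \<subseteq> open_box (0, 1)" if "k \<in> K" for k
    using open_box_relative[OF B[OF i(1)[OF that]] arrangementD(1)[OF c that] i(2)[OF that]]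
    by (auto simp: r_def)
  have h0: "h k 0 = c k" if "k \<in> K" for k
    using that i g(2) B by (simp add: h_def r_def place_relative)
  have gne: "open_box (g (i k) t) \<noteq> {}" if "k \<in> K" "t \<in> {0..1}" for k t
    using arrangementD(1)[OF g(4)[OF that(2)] i(1)[OF that(1)]] .
  have inside: "open_box (h k t) \<subseteq> open_box (g (i k) t)" if "k \<in> K" "t \<in> {0..1}" for k t
    using r(2)[OF that(1)] relative_point_unit[OF gne[OF that]]
    by (auto simp: h_def mem_place_iff[OF gne[OF that]])
  have "arrangement W K (\<lambda>k. h k t)" if t: "t \<in> {0..1}" for t
  proof (rule arrangementI)
    fix k assume k: "k \<in> K"
    show "open_box (h k t) \<noteq> {}" unfolding h_def by (rule open_box_place[OF gne[OF k t] r(1)[OF k]])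
    show "open_box (h k t) \<subseteq> W"
      using inside[OF k t] arrangementD(2)[OF g(4)[OF t] i(1)[OF k]] by blast
  next
    fix k l assume kl: "k \<in> K" "l \<in> K" "k \<noteq> l"
    show "open_box (h k t) \<inter> open_box (h l t) = {}"
    proof (cases "i k = i l")
      case False
      then show ?thesis
        using inside[OF kl(1) t] inside[OF kl(2) t] arrangement_disjoint[OF g(4)[OF t] i(1)[OF kl(1)] i(1)[OF kl(2)]]
        by blast
    next
      case True
      have "open_box (r k) \<inter> open_box (r l) = {}"
      proof (rule ccontr)
        assume "open_box (r k) \<inter> open_box (r l) \<noteq> {}"
        then obtain u where u: "u \<in> open_box (r k)" "u \<in> open_box (r l)" by blast
        let ?b = "B (i k)"
        have "snd ?b $ m - fst ?b $ m > 0" for m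
          using B[OF i(1)[OF kl(1)]] by (simp add: open_box_nonempty)
        then have "relative_point ?b (absolute_point ?b u) = u"
          by (simp add: relative_point_def absolute_point_def vec_eq_iff less_imp_neq[symmetric])
        then have "absolute_point ?b u \<in> open_box (place ?b (r k)) \<inter> open_box (place ?b (r l))"
          using u by (simp add: mem_place_iff[OF B[OF i(1)[OF kl(1)]]])
        then show False
          using arrangement_disjoint[OF c kl] B i(1) kl True by (auto simp: r_def place_relative)
      qed
      then show ?thesis
        using True by (auto simp: h_def mem_place_iff[OF gne[OF kl(1) t]] mem_place_iff[OF gne[OF kl(2) t]])
    qed
  qed
  moreover have "path (h k)" if "k \<in> K" for k
    using g(1)[OF i(1)[OF that]] unfolding path_def h_def place_def absolute_point_def
    by (intro continuous_intros)
  ultimately have "isotopic_rel {} W K c (\<lambda>k. h k 1)"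
    using h0 by (intro isotopic_relI[where g = h]) auto
  moreover have "open_box (h k 1) \<subseteq> open_box (C (i k))" if "k \<in> K" for k
    using inside[OF that, of 1] g(3)[OF i(1)[OF that]] by simp
  ultimately show ?thesis by blast
qed

section \<open>Moving finitely many boxes\<close>

definition small_box :: "real \<Rightarrow> real^'n \<Rightarrow> 'n::finite corners" where
  "small_box e p = ((\<chi> i. p $ i - e), (\<chi> i. p $ i + e))"

lemma center_in_small_box: "0 < e \<Longrightarrow> p \<in> open_box (small_box e p)"
  by (simp add: mem_open_box small_box_def)

lemma small_box_dist:
  fixes p :: "real^'n"
  assumes "q \<in> open_box (small_box e p)"
  shows "dist p q \<le> real CARD('n) * e"
proof -
  have "norm (q - p) \<le> (\<Sum>i\<in>UNIV. \<bar>(q - p) $ i\<bar>)" by (rule norm_le_l1_cart)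
  also have "\<dots> \<le> (\<Sum>i\<in>(UNIV::'n set). e)"
  proof (rule sum_mono)
    fix i
    have "p $ i - e < q $ i" "q $ i < p $ i + e" using assms by (auto simp: mem_open_box small_box_def)
    then show "\<bar>(q - p) $ i\<bar> \<le> e" by (simp add: abs_le_iff)
  qed
  finally show ?thesis by (simp add: dist_norm norm_minus_commute)
qed

lemma eventually_small_boxes_subset:
  fixes A :: "(real^'n) set"
  assumes "compact A" "open V" "A \<subseteq> V"
  shows "\<forall>\<^sub>F e in at_right 0. \<forall>x\<in>A. open_box (small_box e x) \<subseteq> V"
proof -
  obtain d where d: "d > 0" "(\<Union>x\<in>A. ball x d) \<subseteq> V"
    using compact_subset_open_imp_ball_epsilon_subset[OF assms] by metis
  have "open_box (small_box e x) \<subseteq> V" if "x \<in> A" "e \<in> {0<..<d / CARD('n)}" for e x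
  proof
    fix q assume "q \<in> open_box (small_box e x)"
    then have "dist x q \<le> real CARD('n) * e" by (rule small_box_dist)
    also have "\<dots> < d" using that(2) by (simp add: pos_less_divide_eq mult.commute)
    finally have "q \<in> ball x d" by simp
    then show "q \<in> V" using d(2) that(1) by blast
  qed
  then show ?thesis
    using eventually_at_right_real[of 0 "d / CARD('n)"] d(1) by (auto elim!: eventually_mono)
qed

lemma eventually_small_boxes_disjoint:
  fixes A B :: "(real^'n) set"
  assumes "compact A" "compact B" "A \<inter> B = {}"
  shows "\<forall>\<^sub>F e in at_right 0. \<forall>x\<in>A. \<forall>y\<in>B. open_box (small_box e x) \<inter> open_box (small_box e y) = {}"
proof -
  obtain d where d: "d > 0" "(\<Union>x\<in>A. ball x d) \<subseteq> - B"
    using compact_subset_open_imp_ball_epsilon_subset[of A "- B"] assms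
    by (metis Compl_disjoint2 compact_imp_closed disjoint_eq_subset_Compl open_Compl)
  have "open_box (small_box e x) \<inter> open_box (small_box e y) = {}"
    if "x \<in> A" "y \<in> B" "e \<in> {0<..<d / (2 * CARD('n))}" for e x y
  proof (rule ccontr)
    assume "open_box (small_box e x) \<inter> open_box (small_box e y) \<noteq> {}"
    then obtain q where q: "q \<in> open_box (small_box e x)" "q \<in> open_box (small_box e y)" by blast
    have "dist x y \<le> dist x q + dist y q" by (rule dist_triangle2)
    also have "\<dots> \<le> 2 * (real CARD('n) * e)" using small_box_dist[OF q(1)] small_box_dist[OF q(2)] by simp
    also have "\<dots> < d" using that(3) by (simp add: pos_less_divide_eq mult_ac)
    finally have "y \<in> ball x d" by simp
    then show False using d(2) that(1,2) by blast
  qed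
  then show ?thesis
    using eventually_at_right_real[of 0 "d / (2 * CARD('n))"] d(1) by (auto elim!: eventually_mono)
qed

text \<open>
  A size that works for all positions at once: with \<open>A j\<close> the whole trajectory of a point, a single \<open>e\<close>
  serves for the entire motion.
\<close>

lemma eventually_small_boxes_arrangement:
  fixes A :: "'j \<Rightarrow> (real^'n) set"
  assumes "finite J" "open W" "\<And>j. j \<in> J \<Longrightarrow> compact (A j)" "\<And>j. j \<in> J \<Longrightarrow> A j \<subseteq> W"
    and "\<And>i j. i \<in> J \<Longrightarrow> j \<in> J \<Longrightarrow> i \<noteq> j \<Longrightarrow> A i \<inter> A j = {}"
  shows "\<forall>\<^sub>F e in at_right 0. \<forall>x. (\<forall>j\<in>J. x j \<in> A j) \<longrightarrow> arrangement W J (\<lambda>j. small_box e (x j))"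
proof -
  have "\<forall>\<^sub>F e in at_right 0. \<forall>j\<in>J. \<forall>x\<in>A j. open_box (small_box e x) \<subseteq> W"
    using assms by (intro eventually_ball_finite ballI eventually_small_boxes_subset)
  moreover have "\<forall>\<^sub>F e in at_right 0. \<forall>i\<in>J. \<forall>j\<in>J. i \<noteq> j \<longrightarrow>
      (\<forall>x\<in>A i. \<forall>y\<in>A j. open_box (small_box e x) \<inter> open_box (small_box e y) = {})"
  proof (intro eventually_ball_finite ballI assms(1))
    fix i j assume "i \<in> J" "j \<in> J"
    then show "\<forall>\<^sub>F e in at_right 0. i \<noteq> j \<longrightarrow>
        (\<forall>x\<in>A i. \<forall>y\<in>A j. open_box (small_box e x) \<inter> open_box (small_box e y) = {})"
      using eventually_small_boxes_disjoint[of "A i" "A j"] assms by (cases "i = j") auto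
  qed
  moreover have "\<forall>\<^sub>F e in at_right (0::real). 0 < e" by (rule eventually_at_right_less)
  ultimately show ?thesis
  proof eventually_elim
    case (elim e)
    show ?case
    proof (intro allI impI arrangementI)
      fix x j assume "\<forall>j\<in>J. x j \<in> A j" "j \<in> J"
      then show "open_box (small_box e (x j)) \<noteq> {}" "open_box (small_box e (x j)) \<subseteq> W"
        using center_in_small_box[OF elim(3)] elim(1) by blast+
    qed (use elim(2) in blast)
  qed
qed

text \<open>
  In dimension at least \<open>2\<close> the complement of the other points in \<open>W\<close> is still path connected, and
  the moving point has positive distance from the other points by compactness of its trajectory.
\<close>

lemma eventually_move_point:
  fixes p :: "'j \<Rightarrow> real^'n"
  assumes card: "CARD('n) \<ge> 2" and W: "open W" "connected W" and J: "finite J"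
    and p: "inj_on p J" "p ` J \<subseteq> W" and j: "j \<in> J" and q: "q \<in> W" "q \<notin> p ` J"
  shows "\<forall>\<^sub>F e in at_right 0. isotopic_rel {} W J (\<lambda>i. small_box e (p i)) (\<lambda>i. small_box e ((p(j := q)) i))"
proof -
  have "path_connected (W - p ` (J - {j}))"
    using card W J by (intro path_connected_open_diff_countable) (auto intro: countable_finite)
  moreover have "p j \<in> W - p ` (J - {j})" "q \<in> W - p ` (J - {j})"
    using p j q by (auto simp: inj_on_def)
  ultimately obtain \<gamma> where \<gamma>: "path \<gamma>" "path_image \<gamma> \<subseteq> W - p ` (J - {j})" "\<gamma> 0 = p j" "\<gamma> 1 = q"
    unfolding path_connected_def pathstart_def pathfinish_def by metis
  define A where "A i = (if i = j then path_image \<gamma> else {p i})" for i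
  have "\<forall>\<^sub>F e in at_right 0. \<forall>x. (\<forall>i\<in>J. x i \<in> A i) \<longrightarrow> arrangement W J (\<lambda>i. small_box e (x i))"
  proof (rule eventually_small_boxes_arrangement[OF J W(1)])
    fix i l assume "i \<in> J" "l \<in> J" "i \<noteq> l"
    then show "A i \<inter> A l = {}" using \<gamma>(2) p(1) by (auto simp: A_def inj_on_def)
  qed (use \<gamma>(1,2) p(2) in \<open>auto simp: A_def compact_path_image\<close>)
  then show ?thesis
  proof eventually_elim
    case (elim e)
    show ?case
    proof (rule isotopic_relI[where g = "\<lambda>i t. small_box e (if i = j then \<gamma> t else p i)"])
      fix t :: real assume "t \<in> {0..1}"
      then show "arrangement W J (\<lambda>i. small_box e (if i = j then \<gamma> t else p i))"
        using elim[rule_format, of "\<lambda>i. if i = j then \<gamma> t else p i"] by (auto simp: A_def path_image_def)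
    next
      fix i
      show "path (\<lambda>t. small_box e (if i = j then \<gamma> t else p i))"
        using \<gamma>(1) unfolding path_def small_box_def
        by (cases "i = j") (auto intro!: continuous_intros)
    qed (use \<gamma>(3,4) in auto)
  qed
qed

text \<open>
  The points are moved one by one. A target is never occupied: it is not a starting point, hence not
  the place of a point that still waits, and distinct points have distinct targets.
\<close>

lemma eventually_move_points:
  fixes p q :: "'j \<Rightarrow> real^'n"
  assumes card: "CARD('n) \<ge> 2" and W: "open W" "connected W" and J: "finite J"
    and p: "inj_on p J" "p ` J \<subseteq> W" and q: "inj_on q J" "q ` J \<subseteq> W" and pq: "p ` J \<inter> q ` J = {}"
  shows "\<forall>\<^sub>F e in at_right 0. isotopic_rel {} W J (\<lambda>i. small_box e (p i)) (\<lambda>i. small_box e (q i))"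
proof -
  have "\<forall>\<^sub>F e in at_right 0. isotopic_rel {} W J (\<lambda>i. small_box e (p i))
      (\<lambda>i. small_box e (if i \<in> A then q i else p i))" if "finite A" "A \<subseteq> J" for A
    using that
  proof induction
    case empty
    have "\<forall>\<^sub>F e in at_right 0. \<forall>x. (\<forall>i\<in>J. x i \<in> {p i}) \<longrightarrow> arrangement W J (\<lambda>i. small_box e (x i))"
      by (rule eventually_small_boxes_arrangement[OF J W(1)]) (use p in \<open>auto simp: inj_on_def\<close>)
    then show ?case
      by eventually_elim (auto intro: isotopic_rel_eq)
  next
    case (insert a A)
    let ?r = "\<lambda>i. if i \<in> A then q i else p i"
    have "inj_on ?r J"
      using p(1) q(1) pq unfolding inj_on_def by (metis disjoint_iff imageI)
    moreover have "?r ` J \<subseteq> W" "q a \<in> W"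
      using p q insert.prems by auto
    moreover have "q a \<notin> ?r ` J"
      using q(1) pq insert.prems insert.hyps by (auto simp: inj_on_def)
    ultimately have "\<forall>\<^sub>F e in at_right 0. isotopic_rel {} W J (\<lambda>i. small_box e (?r i))
        (\<lambda>i. small_box e ((?r(a := q a)) i))"
      using insert.prems by (intro eventually_move_point[OF card W J]) auto
    moreover have "?r(a := q a) = (\<lambda>i. if i \<in> insert a A then q i else p i)" by auto
    moreover have "\<forall>\<^sub>F e in at_right 0. isotopic_rel {} W J (\<lambda>i. small_box e (p i)) (\<lambda>i. small_box e (?r i))"
      using insert by auto
    ultimately show ?case
      by (auto elim: eventually_elim2 intro: isotopic_rel_trans)
  qed
  from this[OF J order_refl] show ?thesis
  proof eventually_elim
    case (elim e)
    then show ?case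
      using isotopic_rel_trans isotopic_rel_eq[OF isotopic_rel_arrangement(2)[OF elim], of "\<lambda>i. small_box e (q i)"]
      by fastforce
  qed
qed

lemma finite_arrangements_isotopic:
  fixes B C :: "'j \<Rightarrow> 'n::finite corners"
  assumes card: "CARD('n) \<ge> 2" and W: "open W" "connected W" and J: "finite J"
    and B: "arrangement W J B" and C: "arrangement W J C"
  shows "isotopic_rel {} W J B C"
proof -
  have "\<forall>i\<in>J. \<exists>x. x \<in> open_box (B i)" using arrangementD(1)[OF B] by blast
  then obtain p where p: "\<And>i. i \<in> J \<Longrightarrow> p i \<in> open_box (B i)" by metis
  have "\<exists>x. x \<in> open_box (C i) \<and> x \<notin> p ` J" if "i \<in> J" for i
  proof (rule ccontr)
    assume "\<not> ?thesis"
    then have "finite (open_box (C i))" using J by (meson finite_imageI finite_subset subsetI)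
    then show False using arrangementD(1)[OF C that] finite_imp_not_open by (metis open_open_box)
  qed
  then obtain q where q: "\<And>i. i \<in> J \<Longrightarrow> q i \<in> open_box (C i) \<and> q i \<notin> p ` J" by metis
  have "inj_on p J"
  proof (intro inj_onI, rule ccontr)
    fix i l assume "i \<in> J" "l \<in> J" "p i = p l" "i \<noteq> l"
    then show False using arrangement_disjoint[OF B, of i l] p[of i] p[of l] by auto
  qed
  moreover have "inj_on q J"
  proof (intro inj_onI, rule ccontr)
    fix i l assume "i \<in> J" "l \<in> J" "q i = q l" "i \<noteq> l"
    then show False using arrangement_disjoint[OF C, of i l] q[of i] q[of l] by auto
  qed
  moreover have "p i \<in> W" "q i \<in> W" if "i \<in> J" for i
    using p[OF that] q[OF that] arrangementD(2)[OF B that] arrangementD(2)[OF C that] by auto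
  then have "p ` J \<subseteq> W" "q ` J \<subseteq> W" by (simp_all add: image_subset_iff)
  moreover have "p ` J \<inter> q ` J = {}" using q(1) by (intro equals0I) (metis IntE imageE)
  ultimately have "\<forall>\<^sub>F e in at_right 0. isotopic_rel {} W J (\<lambda>i. small_box e (p i)) (\<lambda>i. small_box e (q i))"
    by (intro eventually_move_points[OF card W J])
  moreover have "\<forall>\<^sub>F e in at_right 0. \<forall>i\<in>J. \<forall>x\<in>{p i}. open_box (small_box e x) \<subseteq> open_box (B i)"
    using p by (intro eventually_ball_finite[OF J] ballI eventually_small_boxes_subset) auto
  moreover have "\<forall>\<^sub>F e in at_right 0. \<forall>i\<in>J. \<forall>x\<in>{q i}. open_box (small_box e x) \<subseteq> open_box (C i)"
    using q by (intro eventually_ball_finite[OF J] ballI eventually_small_boxes_subset) auto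
  moreover have "\<forall>\<^sub>F e in at_right (0::real). 0 < e" by (rule eventually_at_right_less)
  ultimately have "\<forall>\<^sub>F e in at_right 0. isotopic_rel {} W J (\<lambda>i. small_box e (p i)) (\<lambda>i. small_box e (q i)) \<and>
      (\<forall>i\<in>J. open_box (small_box e (p i)) \<subseteq> open_box (B i) \<and> open_box (small_box e (q i)) \<subseteq> open_box (C i)) \<and> 0 < e"
    by eventually_elim auto
  then obtain e :: real where "isotopic_rel {} W J (\<lambda>i. small_box e (p i)) (\<lambda>i. small_box e (q i)) \<and>
      (\<forall>i\<in>J. open_box (small_box e (p i)) \<subseteq> open_box (B i) \<and> open_box (small_box e (q i)) \<subseteq> open_box (C i)) \<and> 0 < e"
    by (rule exE[OF eventually_happens'[OF trivial_limit_at_right_real]])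
  then have e: "isotopic_rel {} W J (\<lambda>i. small_box e (p i)) (\<lambda>i. small_box e (q i))"
      "\<And>i. i \<in> J \<Longrightarrow> open_box (small_box e (p i)) \<subseteq> open_box (B i)"
      "\<And>i. i \<in> J \<Longrightarrow> open_box (small_box e (q i)) \<subseteq> open_box (C i)" "0 < e"
    by simp_all
  have ne: "open_box (small_box e x) \<noteq> {}" for x :: "real^'n"
    using center_in_small_box[OF e(4), of x] by auto
  have "isotopic_rel {} W J B (\<lambda>i. small_box e (p i))"
    by (rule isotopic_rel_shrink[OF B ne e(2)])
  also note e(1)
  also have "isotopic_rel {} W J (\<lambda>i. small_box e (q i)) C"
    by (rule isotopic_rel_sym[OF isotopic_rel_shrink[OF C ne e(3)]])
  finally show ?thesis .
qed

text \<open>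
  The box \<open>c k\<close> is shrunk into \<open>B (i k)\<close>, which it meets, and then carried along while the finitely
  many boxes \<open>B j\<close> move to their targets.
\<close>

lemma gather:
  fixes B C :: "'j \<Rightarrow> 'n::finite corners"
  assumes "CARD('n) \<ge> 2" "open W" "connected W" "finite J"
    and B: "arrangement W J B" and C: "arrangement W J C" and c: "arrangement W K c"
    and i: "\<And>k. k \<in> K \<Longrightarrow> i k \<in> J" "\<And>k. k \<in> K \<Longrightarrow> open_box (c k) \<inter> open_box (B (i k)) \<noteq> {}"
  shows "\<exists>d. isotopic_rel {} W K c d \<and> (\<forall>k\<in>K. open_box (d k) \<subseteq> open_box (C (i k)))"
proof -
  have "\<exists>b::'n corners. open_box b \<noteq> {} \<and> open_box b \<subseteq> open_box (c k) \<inter> open_box (B (i k))" if "k \<in> K" for k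
    using open_box_in_open[of "open_box (c k) \<inter> open_box (B (i k))"] i(2)[OF that] by (metis open_Int open_open_box)
  then obtain b where b: "\<And>k. k \<in> K \<Longrightarrow> open_box (b k) \<noteq> {} \<and> open_box (b k) \<subseteq> open_box (c k) \<inter> open_box (B (i k))"
    by metis
  then have 1: "isotopic_rel {} W K c b" by (intro isotopic_rel_shrink[OF c]) auto
  obtain d where "isotopic_rel {} W K b d" "\<forall>k\<in>K. open_box (d k) \<subseteq> open_box (C (i k))"
    using isotopic_rel_carry[OF finite_arrangements_isotopic[OF assms(1-4) B C] isotopic_rel_arrangement(2)[OF 1], of i] i(1) b
    by blast
  then show ?thesis using isotopic_rel_trans[OF 1] by blast
qed

section \<open>Nested sequences of boxes\<close>

lemma isotopic_rel_target:
  assumes "isotopic_rel F W K c d" "\<And>k. k \<in> K \<Longrightarrow> d k = e k"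
  shows "isotopic_rel F W K c e"
  using isotopic_rel_trans[OF assms(1) isotopic_rel_eq[OF isotopic_rel_arrangement(2)[OF assms(1)]]] assms(2)
  by blast

lemma two_disjoint_boxes:
  assumes "open_box z \<noteq> {}"
  obtains l u :: "'n::finite corners"
  where "open_box l \<noteq> {}" "open_box u \<noteq> {}" "open_box l \<subseteq> open_box z" "open_box u \<subseteq> open_box z"
    "open_box l \<inter> open_box u = {}"
proof -
  obtain p where p: "p \<in> open_box z" using assms by blast
  have "open_box z \<noteq> {p}" using not_open_singleton open_open_box by metis
  then obtain q where q: "q \<in> open_box z" "p \<noteq> q" using p by blast
  have "\<forall>\<^sub>F e in at_right 0. \<forall>x. (\<forall>b\<in>UNIV. x b \<in> (if b then {p} else {q})) \<longrightarrow>
      arrangement (open_box z) UNIV (\<lambda>b. small_box e (x b))"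
    using p q by (intro eventually_small_boxes_arrangement) auto
  then obtain e where "\<forall>x. (\<forall>b\<in>UNIV. x b \<in> (if b then {p} else {q})) \<longrightarrow>
      arrangement (open_box z) UNIV (\<lambda>b. small_box e (x b))"
    by (rule exE[OF eventually_happens'[OF trivial_limit_at_right_real]])
  then have a: "arrangement (open_box z) UNIV (\<lambda>b. small_box e (if b then p else q))"
    by simp
  show thesis
    using that[of "small_box e p" "small_box e q"] arrangementD[OF a, of True] arrangementD[OF a, of False]
      arrangement_disjoint[OF a, of True False]
    by simp
qed

text \<open>
  The sequence \<open>T\<close> is the common normal form of all arrangements inside \<open>Z 0\<close>; the box \<open>Z m\<close> is the room
  left for the boxes with index at least \<open>m\<close>.
\<close>

definition nested_boxes :: "(nat \<Rightarrow> 'n::finite corners) \<Rightarrow> (nat \<Rightarrow> 'n corners) \<Rightarrow> bool" where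
  "nested_boxes T Z \<longleftrightarrow>
     (\<forall>m. open_box (T m) \<noteq> {} \<and> open_box (Z m) \<noteq> {} \<and> open_box (T m) \<subseteq> open_box (Z m) \<and>
          open_box (Z (Suc m)) \<subseteq> open_box (Z m) \<and> open_box (T m) \<inter> open_box (Z (Suc m)) = {})"

lemma nested_boxes_exist:
  assumes "open_box z \<noteq> {}"
  obtains T Z :: "nat \<Rightarrow> 'n::finite corners" where "nested_boxes T Z" "Z 0 = z"
proof -
  have "\<forall>z::'n corners. \<exists>l u::'n corners. open_box z \<noteq> {} \<longrightarrow> open_box l \<noteq> {} \<and> open_box u \<noteq> {} \<and>
      open_box l \<subseteq> open_box z \<and> open_box u \<subseteq> open_box z \<and> open_box l \<inter> open_box u = {}"
    by (metis two_disjoint_boxes)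
  then obtain lo up :: "'n corners \<Rightarrow> 'n corners" where lu: "\<And>z. open_box z \<noteq> {} \<Longrightarrow> open_box (lo z) \<noteq> {} \<and>
      open_box (up z) \<noteq> {} \<and> open_box (lo z) \<subseteq> open_box z \<and> open_box (up z) \<subseteq> open_box z \<and>
      open_box (lo z) \<inter> open_box (up z) = {}"
    by metis
  define Z where "Z = rec_nat z (\<lambda>_. up)"
  have Z: "Z 0 = z" "Z (Suc m) = up (Z m)" for m by (simp_all add: Z_def)
  have ne: "open_box (Z m) \<noteq> {}" for m
    by (induction m) (use lu Z assms in auto)
  have "nested_boxes (lo \<circ> Z) Z"
    unfolding nested_boxes_def using lu[OF ne] ne by (simp add: Z(2))
  then show thesis using that Z(1) by blast
qed

lemma nested_boxes_antimono:
  assumes "nested_boxes T Z" "m \<le> n"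
  shows "open_box (Z n) \<subseteq> open_box (Z m)"
  using assms(2) by (induction rule: dec_induct) (use assms(1) in \<open>auto simp: nested_boxes_def\<close>)

lemma nested_boxes_disjoint:
  assumes "nested_boxes T Z" "m < n"
  shows "open_box (T m) \<inter> open_box (Z n) = {}"
  using nested_boxes_antimono[OF assms(1), of "Suc m" n] assms by (auto simp: nested_boxes_def)

lemma nested_boxes_arrangement:
  assumes "nested_boxes T Z"
  shows "arrangement (open_box (Z 0)) K T"
proof (rule arrangementI)
  have sub: "open_box (T k) \<subseteq> open_box (Z k)" for k using assms by (simp add: nested_boxes_def)
  show "open_box (T k) \<noteq> {}" for k using assms by (simp add: nested_boxes_def)
  show "open_box (T k) \<subseteq> open_box (Z 0)" for k
    using sub[of k] nested_boxes_antimono[OF assms, of 0 k] by auto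
  have *: "open_box (T k) \<inter> open_box (T l) = {}" if "k < l" for k l
    using nested_boxes_disjoint[OF assms that] sub[of l] by auto
  show "open_box (T k) \<inter> open_box (T l) = {}" if "k \<noteq> l" for k l
    using *[of k l] *[of l k] that by (auto simp: nat_neq_iff Int_commute)
qed

section \<open>Sorting infinitely many boxes inside a box\<close>

text \<open>
  The cells are the nondegenerate members of a division of \<open>z\<close> that extends the given boxes. An open
  set that avoids the given boxes and all the cells would lie in the union of finitely many
  boundaries of boxes, which is negligible.
\<close>

lemma subdivision:
  fixes c :: "'k \<Rightarrow> 'n::finite corners"
  assumes F: "finite F" and c: "arrangement (open_box z) F c"
  obtains J where "finite J" "arrangement (open_box z - (\<Union>k\<in>F. closed_box (c k))) J (\<lambda>b. b)"
    "\<forall>U. open U \<and> U \<noteq> {} \<and> U \<subseteq> open_box z \<and> (\<forall>k\<in>F. U \<inter> open_box (c k) = {}) \<longrightarrow>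
       (\<exists>b\<in>J. U \<inter> open_box b \<noteq> {})"
proof -
  let ?p = "(\<lambda>k. closed_box (c k)) ` F"
  have sub: "closed_box (c k) \<subseteq> closed_box z" if "k \<in> F" for k
  proof -
    have "open_box (c k) \<subseteq> open_box z" "open_box (c k) \<noteq> {}" using arrangementD[OF c that] by auto
    then show ?thesis using closure_mono closure_open_box by (metis subset_empty)
  qed
  have "?p division_of \<Union>?p"
    unfolding division_of_def
  proof (intro conjI ballI impI)
    fix A assume "A \<in> ?p"
    then obtain k where k: "k \<in> F" "A = closed_box (c k)" by blast
    show "A \<subseteq> \<Union>?p" using \<open>A \<in> ?p\<close> by blast
    show "\<exists>a b. A = cbox a b" using k(2) by (auto simp: closed_box_def)
    show "A \<noteq> {}" using arrangementD(1)[OF c k(1)] k(2) interior_closed_box interior_empty by metis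
    fix B assume "B \<in> ?p" "A \<noteq> B"
    then obtain l where "l \<in> F" "B = closed_box (c l)" "k \<noteq> l" using k by blast
    then show "interior A \<inter> interior B = {}" using arrangement_disjoint[OF c k(1)] k(2) by simp
  qed (use F in auto)
  moreover have "\<Union>?p \<subseteq> cbox (fst z) (snd z)" using sub by (auto simp: closed_box_def)
  ultimately obtain q where q: "?p \<subseteq> q" "q division_of cbox (fst z) (snd z)"
    by (rule partial_division_extend_interval)
  define J where "J = {b :: 'n corners. closed_box b \<in> q - ?p \<and> open_box b \<noteq> {}}"
  have inj: "inj_on closed_box J"
  proof (rule inj_onI)
    fix a b assume ab: "a \<in> J" "b \<in> J" "closed_box a = closed_box b"
    then have "open_box a = open_box b" by (metis interior_closed_box)
    then have "fst a $ i = fst b $ i \<and> snd a $ i = snd b $ i" for i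
      using ab open_box_subset_iff[of a b] open_box_subset_iff[of b a]
      by (auto simp: J_def intro: antisym)
    then show "a = b" by (simp add: prod_eq_iff vec_eq_iff)
  qed
  show thesis
  proof (rule that[of J])
    have "closed_box ` J \<subseteq> q" by (auto simp: J_def)
    then show "finite J" using division_ofD(1)[OF q(2)] inj by (meson finite_imageD finite_subset)
    show "arrangement (open_box z - (\<Union>k\<in>F. closed_box (c k))) J (\<lambda>b. b)"
    proof (rule arrangementI)
      fix b assume b: "b \<in> J"
      show "open_box b \<noteq> {}" using b by (simp add: J_def)
      have "closed_box b \<subseteq> closed_box z"
        using b division_ofD(2)[OF q(2)] by (auto simp: J_def closed_box_def)
      then have "open_box b \<subseteq> open_box z" by (metis interior_mono interior_closed_box)
      moreover have "open_box b \<inter> closed_box (c k) = {}" if "k \<in> F" for k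
      proof (rule open_disjoint_closed_box)
        have "closed_box b \<noteq> closed_box (c k)" "closed_box b \<in> q" "closed_box (c k) \<in> q"
          using b q(1) that by (auto simp: J_def)
        then show "open_box b \<inter> open_box (c k) = {}"
          using division_ofD(5)[OF q(2)] by (metis interior_closed_box)
      qed (use arrangementD(1)[OF c that] in auto)
      ultimately show "open_box b \<subseteq> open_box z - (\<Union>k\<in>F. closed_box (c k))" by blast
    next
      fix a b assume ab: "a \<in> J" "b \<in> J" "a \<noteq> b"
      have "closed_box a \<noteq> closed_box b" using inj_onD[OF inj _ ab(1,2)] ab(3) by blast
      moreover have "closed_box a \<in> q" "closed_box b \<in> q" using ab by (simp_all add: J_def)
      ultimately show "open_box a \<inter> open_box b = {}"
        using division_ofD(5)[OF q(2)] by (metis interior_closed_box)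
    qed
    show "\<forall>U. open U \<and> U \<noteq> {} \<and> U \<subseteq> open_box z \<and> (\<forall>k\<in>F. U \<inter> open_box (c k) = {}) \<longrightarrow>
        (\<exists>b\<in>J. U \<inter> open_box b \<noteq> {})"
    proof (intro allI impI, rule ccontr)
      fix U assume asm: "open U \<and> U \<noteq> {} \<and> U \<subseteq> open_box z \<and> (\<forall>k\<in>F. U \<inter> open_box (c k) = {})"
      then have U: "open U" "U \<noteq> {}" "U \<subseteq> open_box z" "\<And>k. k \<in> F \<Longrightarrow> U \<inter> open_box (c k) = {}" by auto
      assume none: "\<not> (\<exists>b\<in>J. U \<inter> open_box b \<noteq> {})"
      have off: "U \<inter> interior A = {}" if A: "A \<in> q" for A
      proof (cases "A \<in> ?p")
        case True
        then obtain k where "k \<in> F" "A = closed_box (c k)" by blast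
        then show ?thesis using U(4)[of k] by simp
      next
        case False
        obtain a b where "A = cbox a b" using division_ofD(4)[OF q(2) A] by blast
        then have "A = closed_box (a, b)" by (simp add: closed_box_def)
        then show ?thesis using none A False by (auto simp: J_def)
      qed
      have Uq: "U \<subseteq> \<Union>q"
        using U(3) division_ofD(6)[OF q(2)] box_subset_cbox[of "fst z" "snd z"] by (simp add: open_box_def)
      have "U \<subseteq> \<Union>((\<lambda>A. A - interior A) ` q)"
      proof
        fix y assume y: "y \<in> U"
        then obtain A where A: "A \<in> q" "y \<in> A" using Uq by auto
        then have "y \<in> A - interior A" using off[OF A(1)] y by auto
        then show "y \<in> \<Union>((\<lambda>A. A - interior A) ` q)" using A(1) by (intro UN_I)
      qed
      moreover have "negligible (\<Union>((\<lambda>A. A - interior A) ` q))"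
      proof (rule negligible_Union)
        fix B assume "B \<in> (\<lambda>A. A - interior A) ` q"
        then obtain a b where "B = cbox a b - interior (cbox a b)" using division_ofD(4)[OF q(2)] by blast
        then show "negligible B" using negligible_frontier_interval[of a b] by simp
      qed (use division_ofD(1)[OF q(2)] in auto)
      ultimately show False
        using U(1,2) open_not_negligible negligible_subset by blast
    qed
  qed
qed

text \<open>
  One stage of the sorting. Box \<open>m\<close> moves to \<open>t\<close> together with the motion of the finitely many cells
  of its complement, which carry all other boxes to disjoint places inside \<open>y\<close>. The index \<open>m\<close> is allowed to
  lie outside \<open>K\<close>, so that the stages can be numbered by all natural numbers.
\<close>

lemma gather_all_but_one:
  fixes c :: "'k \<Rightarrow> 'n::finite corners"
  assumes card: "CARD('n) \<ge> 2" and c: "arrangement (open_box z) K c"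
    and t: "open_box t \<noteq> {}" "open_box t \<subseteq> open_box z"
    and y: "open_box y \<noteq> {}" "open_box y \<subseteq> open_box z" and ty: "open_box t \<inter> open_box y = {}"
  shows "\<exists>d. isotopic_rel {} (open_box z) K c d \<and> (m \<in> K \<longrightarrow> d m = t) \<and>
    (\<forall>k\<in>K - {m}. open_box (d k) \<subseteq> open_box y)"
proof (cases "m \<in> K")
  case False
  have z: "open_box z \<noteq> {}" using t by blast
  have "\<exists>d. isotopic_rel {} (open_box z) K c d \<and> (\<forall>k\<in>K. open_box (d k) \<subseteq> open_box y)"
    by (rule gather[OF card open_open_box connected_open_box, of "{()}" z "\<lambda>_. z" "\<lambda>_. y" K c "\<lambda>_. ()"])
      (use z y c arrangementD[OF c] in \<open>auto simp: arrangement_def disjoint_family_on_def Int_absorb2\<close>)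
  then show ?thesis using False by auto
next
  case m: True
  have cm: "open_box (c m) \<noteq> {}" "open_box (c m) \<subseteq> open_box z" using arrangementD[OF c m] by auto
  obtain J where J: "finite J" "arrangement (open_box z - (\<Union>k\<in>{m}. closed_box (c k))) J (\<lambda>b. b)"
    and cover: "\<forall>U. open U \<and> U \<noteq> {} \<and> U \<subseteq> open_box z \<and> (\<forall>k\<in>{m}. U \<inter> open_box (c k) = {}) \<longrightarrow>
       (\<exists>b\<in>J. U \<inter> open_box b \<noteq> {})"
  proof (rule subdivision)
    show "arrangement (open_box z) {m} c" using m by (intro arrangement_subset[OF c]) simp
  qed simp
  have Jz: "open_box b \<subseteq> open_box z" "open_box b \<inter> open_box (c m) = {}" "open_box b \<noteq> {}" if "b \<in> J" for b
    using arrangementD[OF J(2) that] interior_subset[of "closed_box (c m)"] by auto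
  have B: "arrangement (open_box z) (insert (c m) J) (\<lambda>b. b)"
  proof (rule arrangementI)
    fix a b assume "a \<in> insert (c m) J" "b \<in> insert (c m) J" "a \<noteq> b"
    then show "open_box a \<inter> open_box b = {}"
      using arrangement_disjoint[OF J(2), of a b] Jz(2)[of a] Jz(2)[of b] by auto
  qed (use Jz cm in auto)
  obtain T Z where T: "nested_boxes T Z" "Z 0 = y" using nested_boxes_exist[OF y(1)] .
  note Ty = nested_boxes_arrangement[OF T(1), unfolded T(2)]
  \<comment> \<open>Box \<open>m\<close> goes to \<open>t\<close>, the cells to distinct members of a disjoint sequence inside \<open>y\<close>.\<close>
  obtain h :: "'n corners \<Rightarrow> nat" where h: "inj_on h J"
    using finite_imp_inj_to_nat_seg[OF J(1)] by blast
  define C where "C b = (if b = c m then t else T (h b))" for b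
  have C: "arrangement (open_box z) (insert (c m) J) C"
  proof (rule arrangementI)
    fix a b assume ab: "a \<in> insert (c m) J" "b \<in> insert (c m) J" "a \<noteq> b"
    then have "h a \<noteq> h b" if "a \<noteq> c m" "b \<noteq> c m" using h that by (auto simp: inj_on_def)
    then show "open_box (C a) \<inter> open_box (C b) = {}"
      using ab ty arrangement_disjoint[OF Ty UNIV_I UNIV_I, of "h a" "h b"]
        arrangementD(2)[OF Ty UNIV_I, of "h a"] arrangementD(2)[OF Ty UNIV_I, of "h b"]
      by (auto simp: C_def)
  next
    fix b
    show "open_box (C b) \<noteq> {}" using t(1) arrangementD(1)[OF Ty UNIV_I] by (simp add: C_def)
    show "open_box (C b) \<subseteq> open_box z"
      using t(2) subset_trans[OF arrangementD(2)[OF Ty UNIV_I] y(2)] by (simp add: C_def)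
  qed
  have "\<exists>b\<in>J. open_box (c k) \<inter> open_box b \<noteq> {}" if "k \<in> K - {m}" for k
    using that arrangementD[OF c, of k] arrangement_disjoint[OF c, of k m] m
    by (intro cover[rule_format]) auto
  then obtain i where i: "\<And>k. k \<in> K - {m} \<Longrightarrow> i k \<in> J \<and> open_box (c k) \<inter> open_box (i k) \<noteq> {}"
    by metis
  have "\<exists>d. isotopic_rel {} (open_box z) K c d \<and>
      (\<forall>k\<in>K. open_box (d k) \<subseteq> open_box (C ((i(m := c m)) k)))"
    by (rule gather[OF card open_open_box connected_open_box _ B C c]) (use J(1) i cm in auto)
  then obtain d where d: "isotopic_rel {} (open_box z) K c d"
    and dC: "\<And>k. k \<in> K \<Longrightarrow> open_box (d k) \<subseteq> open_box (C ((i(m := c m)) k))"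
    by blast
  have dm: "open_box (d m) \<subseteq> open_box t" using dC[OF m] by (simp add: C_def)
  have dy: "open_box (d k) \<subseteq> open_box y" if "k \<in> K - {m}" for k
  proof -
    have "i k \<noteq> c m" using i[OF that] Jz(2)[of "c m"] cm by auto
    then show ?thesis using dC[of k] that arrangementD(2)[OF Ty UNIV_I, of "h (i k)"] by (auto simp: C_def)
  qed
  note ad = isotopic_rel_arrangement(2)[OF d]
  \<comment> \<open>Box \<open>m\<close> has only reached a subbox of \<open>t\<close>. Expanding it to \<open>t\<close> hits no other box, as those are in \<open>y\<close>.\<close>
  have "arrangement (open_box z) K (d(m := t))"
  proof (rule arrangementI)
    fix k l assume kl: "k \<in> K" "l \<in> K" "k \<noteq> l"
    show "open_box ((d(m := t)) k) \<inter> open_box ((d(m := t)) l) = {}"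
      using arrangement_disjoint[OF ad kl] dy[of k] dy[of l] kl ty by auto
  next
    fix k assume "k \<in> K"
    then show "open_box ((d(m := t)) k) \<noteq> {}" "open_box ((d(m := t)) k) \<subseteq> open_box z"
      using arrangementD[OF ad, of k] t by auto
  qed
  then have "isotopic_rel {} (open_box z) K (d(m := t)) d"
    using dm by (rule_tac isotopic_rel_shrink) (auto simp: arrangementD(1)[OF ad])
  then have "isotopic_rel {} (open_box z) K c (d(m := t))"
    using d by (blast intro: isotopic_rel_trans isotopic_rel_sym)
  then show ?thesis using dy by (intro exI[of _ "d(m := t)"]) auto
qed

text \<open>
  Infinitely many motions are performed one after the other, the \<open>m\<close>-th during the interval from
  \<open>1 - 1 / (m + 1)\<close> to \<open>1 - 1 / (m + 2)\<close>. Box \<open>k\<close> takes part in the motions up to the \<open>k\<close>-th only, so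
  its path is a finite sum of continuous displacements, and it is continuous at time \<open>1\<close> as well.
\<close>

lemma isotopic_rel_limit:
  fixes K :: "nat set" and c :: "nat \<Rightarrow> nat \<Rightarrow> 'n::finite corners"
  assumes iso: "\<And>m. isotopic_rel {k. k < m} W K (c m) (c (Suc m))"
  shows "isotopic_rel {} W K (c 0) (\<lambda>k. c (Suc k) k)"
proof -
  obtain g where g: "\<And>m. isotopy {k. k < m} W K (c m) (c (Suc m)) (g m)"
    using iso unfolding isotopic_rel_def by metis
  note gD = isotopyD[OF g]
  define \<tau> where "\<tau> m = 1 - 1 / (real m + 1)" for m :: nat
  define \<theta> where "\<theta> m t = max 0 (min 1 ((t - \<tau> m) / (\<tau> (Suc m) - \<tau> m)))" for m t
  \<comment> \<open>The local clock \<open>\<theta> m\<close> runs from \<open>0\<close> to \<open>1\<close> during stage \<open>m\<close> and rests before and after it.\<close>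
  define h where "h k t = c 0 k + (\<Sum>m<Suc k. g m k (\<theta> m t) - c m k)" for k t
  have \<tau>_less: "\<tau> m < \<tau> (Suc m)" for m
    by (simp add: \<tau>_def frac_less2)
  have \<tau>_le: "\<tau> m \<le> \<tau> n" if "m \<le> n" for m n
    using that by (simp add: \<tau>_def frac_le)
  have \<theta>01: "\<theta> m t \<in> {0..1}" for m t by (simp add: \<theta>_def)
  have \<theta>_0: "\<theta> m t = 0" if "t \<le> \<tau> m" for m t
    using that \<tau>_less[of m] by (simp add: \<theta>_def divide_nonpos_pos min.coboundedI2 max_absorb1)
  have \<theta>_1: "\<theta> m t = 1" if "\<tau> (Suc m) \<le> t" for m t
    using that \<tau>_less[of m] by (simp add: \<theta>_def le_divide_eq_1)
  have const: "c (Suc m) k = c m k" if "k \<in> K" "k < m" for m k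
    using gD(5)[of k m 1] gD(3)[of k m] that by simp
  have stable: "c n k = c (Suc k) k" if "k \<in> K" "Suc k \<le> n" for n k
    using that(2) by (induction rule: dec_induct) (use const[OF that(1)] in auto)
  \<comment> \<open>the summands with index above \<open>k\<close> vanish\<close>
  have h_sum: "h k t = c 0 k + (\<Sum>m<N. g m k (\<theta> m t) - c m k)" if "k \<in> K" "Suc k \<le> N" for k t N
  proof -
    have "(\<Sum>m<Suc k. g m k (\<theta> m t) - c m k) = (\<Sum>m<N. g m k (\<theta> m t) - c m k)"
      using that by (intro sum.mono_neutral_left) (auto simp: gD(5)[OF _ that(1) \<theta>01])
    then show ?thesis by (simp only: h_def)
  qed
  have h_stage: "h k t = g M k (\<theta> M t)" if "k \<in> K" "\<tau> M \<le> t" "t \<le> \<tau> (Suc M)" for k t M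
  proof -
    have "h k t = c 0 k + (\<Sum>m<Suc M + Suc k. g m k (\<theta> m t) - c m k)"
      using that(1) by (intro h_sum) auto
    also have "(\<Sum>m<Suc M + Suc k. g m k (\<theta> m t) - c m k) = (\<Sum>m<Suc M. g m k (\<theta> m t) - c m k)"
    proof (rule sum.mono_neutral_right)
      show "\<forall>m\<in>{..<Suc M + Suc k} - {..<Suc M}. g m k (\<theta> m t) - c m k = 0"
      proof
        fix m assume "m \<in> {..<Suc M + Suc k} - {..<Suc M}"
        then have "t \<le> \<tau> m" using \<tau>_le[of "Suc M" m] that(3) by simp
        then show "g m k (\<theta> m t) - c m k = 0" using \<theta>_0 gD(2)[OF that(1)] by simp
      qed
    qed auto
    also have "\<dots> = (\<Sum>m<M. c (Suc m) k - c m k) + (g M k (\<theta> M t) - c M k)"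
    proof -
      have "g m k (\<theta> m t) = c (Suc m) k" if m: "m < M" for m
        using \<theta>_1[of m t] \<tau>_le[of "Suc m" M] m \<open>\<tau> M \<le> t\<close> gD(3)[OF \<open>k \<in> K\<close>] by simp
      then show ?thesis by simp
    qed
    also have "(\<Sum>m<M. c (Suc m) k - c m k) = c M k - c 0 k" by (rule sum_lessThan_telescope)
    finally show ?thesis by simp
  qed
  have h_0: "h k 0 = c 0 k" if "k \<in> K" for k
    using h_stage[OF that, of 0 0] gD(2)[OF that] \<theta>_0[of 0 0] \<tau>_less[of 0] by (simp add: \<tau>_def)
  have h_1: "h k 1 = c (Suc k) k" if "k \<in> K" for k
  proof -
    have "\<theta> m 1 = 1" for m by (rule \<theta>_1) (simp add: \<tau>_def)
    then have "h k 1 = c 0 k + (\<Sum>m<Suc k. c (Suc m) k - c m k)"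
      unfolding h_def using gD(3)[OF that] by simp
    also have "(\<Sum>m<Suc k. c (Suc m) k - c m k) = c (Suc k) k - c 0 k"
      by (rule sum_lessThan_telescope)
    finally show ?thesis by simp
  qed
  show ?thesis
  proof (rule isotopic_relI[where g = h])
    fix t :: real assume t: "t \<in> {0..1}"
    show "arrangement W K (\<lambda>k. h k t)"
    proof (cases "t = 1")
      case True
      show ?thesis
      proof (rule arrangementI)
        fix k l assume kl: "k \<in> K" "l \<in> K" "k \<noteq> l"
        \<comment> \<open>Both boxes rest after stage \<open>max k l\<close>, so at time \<open>1\<close> they are in their positions in one arrangement.\<close>
        have "h k t = c (Suc (max k l)) k" "h l t = c (Suc (max k l)) l"
          using True h_1 stable[of k "Suc (max k l)"] stable[of l "Suc (max k l)"] kl by auto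
        then show "open_box (h k t) \<inter> open_box (h l t) = {}"
          using arrangement_disjoint[OF isotopic_rel_arrangement(1)[OF iso] kl] by simp
      next
        fix k assume "k \<in> K"
        then show "open_box (h k t) \<noteq> {}" "open_box (h k t) \<subseteq> W"
          using arrangementD[OF isotopic_rel_arrangement(1)[OF iso], of k] True h_1 by auto
      qed
    next
      case False
      have "\<exists>m. t < \<tau> (Suc m)"
      proof -
        obtain m :: nat where "1 / (1 - t) < real m" using reals_Archimedean2 by blast
        then have "1 < real m * (1 - t)" using t False by (simp add: pos_divide_less_eq)
        also have "\<dots> \<le> (1 - t) * (real m + 2)" using t by (simp add: algebra_simps)
        finally have "1 / (real m + 2) < 1 - t" by (simp add: pos_divide_less_eq)
        then show ?thesis by (intro exI[of _ m]) (simp add: \<tau>_def add.commute)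
      qed
      define M where "M = (LEAST m. t < \<tau> (Suc m))"
      have M: "t < \<tau> (Suc M)" unfolding M_def using \<open>\<exists>m. t < \<tau> (Suc m)\<close> by (rule LeastI_ex)
      have "\<tau> M \<le> t"
      proof (cases M)
        case 0
        then show ?thesis using t by (simp add: \<tau>_def)
      next
        case (Suc m)
        then show ?thesis using not_less_Least[of m "\<lambda>m. t < \<tau> (Suc m)"] by (simp add: M_def)
      qed
      then have "\<And>k. k \<in> K \<Longrightarrow> h k t = g M k (\<theta> M t)" using M h_stage by simp
      then show ?thesis
        using arrangement_cong[of K "\<lambda>k. h k t" "\<lambda>k. g M k (\<theta> M t)" W] gD(4)[OF \<theta>01] by simp
    qed
  next
    fix k assume k: "k \<in> K"
    have \<theta>_cont: "continuous_on {0..1} (\<theta> m)" for m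
      unfolding \<theta>_def using \<tau>_less[of m] by (intro continuous_intros) auto
    have "continuous_on {0..1} (\<lambda>t. g m k (\<theta> m t))" for m
      by (rule continuous_on_compose2[OF gD(1)[OF k, unfolded path_def] \<theta>_cont]) (use \<theta>01 in auto)
    then show "path (h k)"
      unfolding path_def h_def by (intro continuous_intros)
  qed (use h_0 h_1 in auto)
qed

text \<open>
  Iterating \<open>gather_all_but_one\<close> in \<open>Z 0\<close>, \<open>Z 1\<close>, and so on. After \<open>n\<close> stages the boxes with index
  below \<open>n\<close> are in place, off \<open>Z n\<close>, so that they need not move any more.
\<close>

lemma isotopic_nested_boxes:
  fixes c :: "nat \<Rightarrow> 'n::finite corners"
  assumes card: "CARD('n) \<ge> 2" and TZ: "nested_boxes T Z" and c: "arrangement (open_box (Z 0)) K c"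
  shows "isotopic_rel {} (open_box (Z 0)) K c T"
proof -
  have T: "open_box (T m) \<noteq> {}" "open_box (T m) \<subseteq> open_box (Z m)" "open_box (Z (Suc m)) \<noteq> {}"
    "open_box (Z (Suc m)) \<subseteq> open_box (Z m)" "open_box (T m) \<inter> open_box (Z (Suc m)) = {}" for m
    using TZ by (auto simp: nested_boxes_def)
  \<comment> \<open>The last clause makes the sequence obtained from \<open>P\<close> by dependent choice start at \<open>c\<close>.\<close>
  define P where "P n d \<longleftrightarrow> arrangement (open_box (Z 0)) K d \<and> (\<forall>k\<in>K. k < n \<longrightarrow> d k = T k) \<and>
      (\<forall>k\<in>K. n \<le> k \<longrightarrow> open_box (d k) \<subseteq> open_box (Z n)) \<and> (n = 0 \<longrightarrow> d = c)" for n d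
  have step: "\<exists>d'. P (Suc n) d' \<and> isotopic_rel {k. k < n} (open_box (Z 0)) K d d'" if "P n d" for n d
  proof -
    let ?K = "K - {k. k < n}"
    have d: "arrangement (open_box (Z 0)) K d" "\<And>k. k \<in> K \<Longrightarrow> k < n \<Longrightarrow> d k = T k"
      "\<And>k. k \<in> K \<Longrightarrow> n \<le> k \<Longrightarrow> open_box (d k) \<subseteq> open_box (Z n)"
      using that by (auto simp: P_def)
    have "arrangement (open_box (Z n)) ?K d"
      by (rule arrangementI) (use d arrangement_disjoint[OF d(1)] arrangementD(1)[OF d(1)] in auto)
    then obtain e where e: "isotopic_rel {} (open_box (Z n)) ?K d e" "n \<in> ?K \<Longrightarrow> e n = T n"
      "\<And>k. k \<in> ?K - {n} \<Longrightarrow> open_box (e k) \<subseteq> open_box (Z (Suc n))"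
      using gather_all_but_one[OF card _ T(1)[of n] T(2)[of n] T(3)[of n] T(4)[of n] T(5)[of n], of ?K d n]
      by blast
    define d' where "d' k = (if k < n then d k else e k)" for k
    have "isotopic_rel {} (open_box (Z n)) ?K d d'"
      by (rule isotopic_rel_target[OF e(1)]) (auto simp: d'_def)
    then have iso: "isotopic_rel {k. k < n} (open_box (Z 0)) K d d'"
    proof (rule isotopic_rel_union[OF _ d(1)])
      show "open_box (Z n) \<subseteq> open_box (Z 0)" by (rule nested_boxes_antimono[OF TZ]) simp
      fix k assume "k \<in> {k. k < n} \<inter> K"
      then show "open_box (d k) \<inter> open_box (Z n) = {}" "d k = d' k"
        using nested_boxes_disjoint[OF TZ, of k n] d(2) by (auto simp: d'_def)
    qed
    moreover have "P (Suc n) d'"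
      unfolding P_def
    proof (intro conjI ballI impI)
      show "arrangement (open_box (Z 0)) K d'" by (rule isotopic_rel_arrangement(2)[OF iso])
      fix k assume "k \<in> K" "k < Suc n"
      then show "d' k = T k" using d(2) e(2) by (auto simp: d'_def less_Suc_eq)
    next
      fix k assume "k \<in> K" "Suc n \<le> k"
      then show "open_box (d' k) \<subseteq> open_box (Z (Suc n))" using e(3)[of k] by (auto simp: d'_def)
    qed simp
    ultimately show ?thesis by blast
  qed
  have "\<exists>d. P 0 d" using c arrangementD(2)[OF c] by (auto simp: P_def)
  then obtain d where d: "\<And>n. P n (d n)" "\<And>n. isotopic_rel {k. k < n} (open_box (Z 0)) K (d n) (d (Suc n))"
    using dependent_nat_choice[of P "\<lambda>n. isotopic_rel {k. k < n} (open_box (Z 0)) K"] step by metis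
  have "isotopic_rel {} (open_box (Z 0)) K (d 0) (\<lambda>k. d (Suc k) k)" by (rule isotopic_rel_limit[OF d(2)])
  moreover have "d 0 = c" using d(1)[of 0] by (simp add: P_def)
  ultimately show ?thesis
    using d(1)[of "Suc _"] by (auto simp: P_def intro: isotopic_rel_target)
qed

text \<open>
  Both arrangements are brought to the same normal form \<open>T\<close> inside one of the boxes off \<open>F\<close>, through
  the open connected set \<open>V\<close> that remains when the resting boxes are removed.
\<close>

theorem arrangements_isotopic_rel:
  fixes c d :: "nat \<Rightarrow> 'n::finite corners"
  assumes card: "CARD('n) \<ge> 2" and F: "finite F" "F \<subseteq> K"
    and c: "arrangement (open_box z) K c" and d: "arrangement (open_box z) K d"
    and eq: "\<And>k. k \<in> F \<Longrightarrow> c k = d k"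
    and conn: "connected (open_box z - (\<Union>k\<in>F. closed_box (c k)))"
  shows "isotopic_rel F (open_box z) K c d"
proof (cases "K \<subseteq> F")
  case True
  then show ?thesis using eq by (intro isotopic_rel_eq[OF c]) auto
next
  case False
  then obtain m where m: "m \<in> K - F" by blast
  define V where "V = open_box z - (\<Union>k\<in>F. closed_box (c k))"
  have V: "open V" "connected V"
    using conn F(1) by (auto simp: V_def closed_box_def intro!: open_Diff closed_UN)
  have inV: "arrangement V (K - F) b"
    if b: "arrangement (open_box z) K b" "\<And>k. k \<in> F \<Longrightarrow> c k = b k" for b
  proof (rule arrangementI)
    fix k assume k: "k \<in> K - F"
    have "open_box (b k) \<inter> closed_box (c l) = {}" if "l \<in> F" for l
      using arrangement_disjoint[OF b(1), of k l] arrangementD(1)[OF b(1), of l] k that F(2) b(2)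
      by (intro open_disjoint_closed_box) auto
    then show "open_box (b k) \<subseteq> V" using arrangementD(2)[OF b(1), of k] k by (auto simp: V_def)
  qed (use arrangement_disjoint[OF b(1)] arrangementD(1)[OF b(1)] in auto)
  have cV: "arrangement V (K - F) c" and dV: "arrangement V (K - F) d"
    using inV[OF c] inV[OF d] eq by auto
  obtain J where J: "finite J" "arrangement V J (\<lambda>b. b)"
    and cover: "\<forall>U. open U \<and> U \<noteq> {} \<and> U \<subseteq> open_box z \<and> (\<forall>k\<in>F. U \<inter> open_box (c k) = {}) \<longrightarrow>
       (\<exists>b\<in>J. U \<inter> open_box b \<noteq> {})"
    unfolding V_def by (rule subdivision[OF F(1) arrangement_subset[OF c F(2)]])
  obtain h :: "'n corners \<Rightarrow> nat" where h: "inj_on h J"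
    using finite_imp_inj_to_nat_seg[OF J(1)] by blast
  obtain T Z where T: "nested_boxes T Z" "Z 0 = c m"
    using nested_boxes_exist[OF arrangementD(1)[OF cV m]] .
  note Tm = nested_boxes_arrangement[OF T(1), unfolded T(2)]
  have mV: "open_box (c m) \<subseteq> V" by (rule arrangementD(2)[OF cV m])
  have C: "arrangement V J (\<lambda>b. T (h b))"
  proof (rule arrangementI)
    fix a b assume "a \<in> J" "b \<in> J" "a \<noteq> b"
    then have "h a \<noteq> h b" using h by (auto simp: inj_on_def)
    then show "open_box (T (h a)) \<inter> open_box (T (h b)) = {}"
      by (rule arrangement_disjoint[OF Tm UNIV_I UNIV_I])
  qed (use arrangementD[OF Tm UNIV_I] mV in auto)
  have to_T: "isotopic_rel {} V (K - F) b T" if b: "arrangement V (K - F) b" for b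
  proof -
    have "\<exists>j\<in>J. open_box (b k) \<inter> open_box j \<noteq> {}" if k: "k \<in> K - F" for k
    proof (rule cover[rule_format], intro conjI ballI)
      have bV: "open_box (b k) \<subseteq> V" by (rule arrangementD(2)[OF b k])
      show "open_box (b k) \<noteq> {}" by (rule arrangementD(1)[OF b k])
      show "open_box (b k) \<subseteq> open_box z" using bV by (auto simp: V_def)
      show "open_box (b k) \<inter> open_box (c l) = {}" if "l \<in> F" for l
        using bV that interior_subset[of "closed_box (c l)"] by (auto simp: V_def)
    qed simp
    then obtain i where i: "\<And>k. k \<in> K - F \<Longrightarrow> i k \<in> J" "\<And>k. k \<in> K - F \<Longrightarrow> open_box (b k) \<inter> open_box (i k) \<noteq> {}"
      by metis
    obtain e where e: "isotopic_rel {} V (K - F) b e"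
      and eT: "\<And>k. k \<in> K - F \<Longrightarrow> open_box (e k) \<subseteq> open_box (T (h (i k)))"
      using gather[OF card V J(1,2) C b i] by blast
    note ae = isotopic_rel_arrangement(2)[OF e]
    have "arrangement (open_box (Z 0)) (K - F) e"
      by (rule arrangementI)
        (use arrangement_disjoint[OF ae] arrangementD(1)[OF ae] eT arrangementD(2)[OF Tm UNIV_I] T(2) in fastforce)+
    from isotopic_nested_boxes[OF card T(1) this]
    have "isotopic_rel {} V (K - F) e T"
      using mV by (auto simp: T(2) intro: isotopic_rel_mono)
    with e show ?thesis by (rule isotopic_rel_trans)
  qed
  have "isotopic_rel {} V (K - F) c d"
    using to_T[OF cV] isotopic_rel_sym[OF to_T[OF dV]] by (rule isotopic_rel_trans)
  then show ?thesis
  proof (rule isotopic_rel_union[OF _ c])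
    fix k assume k: "k \<in> F \<inter> K"
    show "open_box (c k) \<inter> V = {}"
      using k interior_subset[of "closed_box (c k)"] by (auto simp: V_def)
    show "c k = d k" using eq k by simp
  qed (auto simp: V_def)
qed

section \<open>From isotopies to homotopies\<close>

text \<open>
  At each point at most one \<open>h k\<close> differs from \<open>x\<close>, and \<open>H\<close> takes the value of that one. If an open set
  \<open>U\<close> misses \<open>x\<close>, its preimage under \<open>H\<close> is the union of its preimages under all the \<open>h k\<close>. If \<open>U\<close>
  contains \<open>x\<close>, it is the intersection of those preimages, and all but finitely many of them are the
  whole space.
\<close>

lemma continuous_map_join:
  assumes h: "\<And>k. k \<in> K \<Longrightarrow> continuous_map Z X (h k)"
    and sel: "\<And>z. z \<in> topspace Z \<Longrightarrow> \<exists>k\<in>K. H z = h k z \<and> (\<forall>j\<in>K - {k}. h j z = x)"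
    and null: "\<And>U. openin X U \<Longrightarrow> x \<in> U \<Longrightarrow> finite {k\<in>K. \<not> h k ` topspace Z \<subseteq> U}"
  shows "continuous_map Z X H"
  unfolding continuous_map_def
proof (intro conjI allI impI)
  show "H \<in> topspace Z \<rightarrow> topspace X"
  proof
    fix z assume z: "z \<in> topspace Z"
    then obtain k where "k \<in> K" "H z = h k z" using sel by blast
    then show "H z \<in> topspace X" using h[of k] z by (auto simp: continuous_map_def)
  qed
  fix U assume U: "openin X U"
  have op: "openin Z {z \<in> topspace Z. h k z \<in> U}" if "k \<in> K" for k
    using openin_continuous_map_preimage[OF h[OF that] U] .
  show "openin Z {z \<in> topspace Z. H z \<in> U}"
  proof (cases "x \<in> U")
    case False
    have "{z \<in> topspace Z. H z \<in> U} = (\<Union>k\<in>K. {z \<in> topspace Z. h k z \<in> U})"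
    proof (intro set_eqI iffI)
      fix z assume "z \<in> {z \<in> topspace Z. H z \<in> U}"
      then show "z \<in> (\<Union>k\<in>K. {z \<in> topspace Z. h k z \<in> U})" using sel[of z] by auto
    next
      fix z assume "z \<in> (\<Union>k\<in>K. {z \<in> topspace Z. h k z \<in> U})"
      then obtain j where j: "j \<in> K" "z \<in> topspace Z" "h j z \<in> U" by blast
      then obtain k where k: "k \<in> K" "H z = h k z" "\<forall>j\<in>K - {k}. h j z = x" using sel by blast
      have "j = k" using j k(3) False by auto
      then show "z \<in> {z \<in> topspace Z. H z \<in> U}" using j k(2) by simp
    qed
    then show ?thesis using op by auto
  next
    case True
    define B where "B = {k\<in>K. \<not> h k ` topspace Z \<subseteq> U}"
    have "{z \<in> topspace Z. H z \<in> U} = topspace Z \<inter> (\<Inter>k\<in>B. {z \<in> topspace Z. h k z \<in> U})"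
    proof (intro set_eqI iffI)
      fix z assume z: "z \<in> {z \<in> topspace Z. H z \<in> U}"
      then obtain k where k: "k \<in> K" "H z = h k z" "\<forall>j\<in>K - {k}. h j z = x" using sel by blast
      have "h j z \<in> U" if "j \<in> K" for j using k z True that by (cases "j = k") auto
      then show "z \<in> topspace Z \<inter> (\<Inter>k\<in>B. {z \<in> topspace Z. h k z \<in> U})" using z by (auto simp: B_def)
    next
      fix z assume z: "z \<in> topspace Z \<inter> (\<Inter>k\<in>B. {z \<in> topspace Z. h k z \<in> U})"
      then obtain k where k: "k \<in> K" "H z = h k z" using sel by blast
      then show "z \<in> {z \<in> topspace Z. H z \<in> U}" using z by (cases "k \<in> B") (auto simp: B_def)
    qed
    moreover have "finite B" unfolding B_def by (rule null[OF U True])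
    ultimately show ?thesis
      using op by (auto simp: B_def intro!: openin_Int_Inter)
  qed
qed

text \<open>
  A path in \<open>C - P\<close> has positive distance from \<open>P\<close>, so it may be contracted slightly towards its
  interior starting point; by convexity this puts all of it into the interior of \<open>C\<close>.
\<close>

lemma path_connected_interior_diff:
  fixes C :: "'a::euclidean_space set"
  assumes C: "convex C" and P: "closed P" and pc: "path_connected (C - P)"
  shows "path_connected (interior C - P)"
  unfolding path_connected_component
proof (intro ballI)
  fix p q assume p: "p \<in> interior C - P" and q: "q \<in> interior C - P"
  then have "p \<in> C - P" "q \<in> C - P" using interior_subset by auto
  then obtain \<gamma> where \<gamma>: "path \<gamma>" "path_image \<gamma> \<subseteq> C - P" "\<gamma> 0 = p" "\<gamma> 1 = q"
    using pc unfolding path_connected_def pathstart_def pathfinish_def by blast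
  obtain d where d: "d > 0" "(\<Union>u\<in>path_image \<gamma>. ball u d) \<subseteq> - P"
    using compact_subset_open_imp_ball_epsilon_subset[OF compact_path_image[OF \<gamma>(1)], of "- P"] P \<gamma>(2)
    by (metis Diff_eq le_inf_iff open_Compl)
  have "bounded ((\<lambda>u. u - p) ` path_image \<gamma>)"
    using bounded_path_image[OF \<gamma>(1)] by (rule bounded_translation_minus)
  then obtain M where M: "M > 0" "\<And>u. u \<in> path_image \<gamma> \<Longrightarrow> norm (u - p) \<le> M"
    unfolding bounded_pos by auto
  define s where "s = min 1 (d / (2 * M))"
  have s: "0 < s" "s \<le> 1" "s * M < d"
  proof -
    show "0 < s" "s \<le> 1" using d M by (auto simp: s_def)
    have "s * M \<le> d / (2 * M) * M" using M(1) by (intro mult_right_mono) (auto simp: s_def)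
    also have "\<dots> < d" using M(1) d(1) by simp
    finally show "s * M < d" .
  qed
  \<comment> \<open>pulling a point of the path slightly towards \<open>p\<close> brings it into the interior and stays off \<open>P\<close>\<close>
  have pull: "u - r *\<^sub>R (u - p) \<in> interior C - P"
    if u: "u \<in> path_image \<gamma>" and r: "r \<in> {0..s}" "u \<in> interior C \<or> 0 < r" for u r
  proof -
    have "u - r *\<^sub>R (u - p) \<in> interior C"
    proof (cases "r = 0")
      case False
      have "u \<in> C" using u \<gamma>(2) by blast
      then show ?thesis using mem_interior_convex_shrink[OF C, of p u r] p r s(2) False by auto
    qed (use r in auto)
    moreover have "norm (r *\<^sub>R (u - p)) < d"
    proof -
      have "r * norm (u - p) \<le> s * M" using r M(2)[OF u] s(1) by (intro mult_mono) auto
      then show ?thesis using s(3) r(1) by simp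
    qed
    then have "u - r *\<^sub>R (u - p) \<in> ball u d" by (simp add: dist_norm)
    ultimately show ?thesis using d(2) u by blast
  qed
  have ends: "p \<in> path_image \<gamma>" "q \<in> path_image \<gamma>" using \<gamma>(3,4) by (force simp: path_image_def)+
  have "path_component (interior C - P) (p - s *\<^sub>R (p - p)) (q - s *\<^sub>R (q - p))"
    unfolding path_component_def
  proof (intro exI conjI)
    show "path (\<lambda>t. \<gamma> t - s *\<^sub>R (\<gamma> t - p))"
      using \<gamma>(1) unfolding path_def by (intro continuous_intros)
    show "path_image (\<lambda>t. \<gamma> t - s *\<^sub>R (\<gamma> t - p)) \<subseteq> interior C - P"
      using pull[of _ s] s(1) by (force simp: path_image_def)
  qed (simp_all add: pathstart_def pathfinish_def \<gamma>)
  moreover have "path_component (interior C - P) (q - s *\<^sub>R (q - p)) q"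
    unfolding path_component_def
  proof (intro exI conjI)
    let ?l = "\<lambda>t. q - (s * (1 - t)) *\<^sub>R (q - p)"
    show "path ?l" unfolding path_def by (intro continuous_intros)
    show "path_image ?l \<subseteq> interior C - P"
    proof
      fix y assume "y \<in> path_image ?l"
      then obtain t where t: "t \<in> {0..1}" "y = ?l t" by (auto simp: path_image_def)
      have "s * (1 - t) \<in> {0..s}" using t(1) s(1) by (simp add: mult_left_le)
      then show "y \<in> interior C - P" using pull[OF ends(2)] q t(2) by simp
    qed
  qed (simp_all add: pathstart_def pathfinish_def)
  ultimately show "path_component (interior C - P) p q"
    using path_component_trans by fastforce
qed

lemma concatenation_cong:
  assumes "\<And>k. k \<in> K \<Longrightarrow> R k = S k"
  shows "concatenation x K R f = concatenation x K S f"
proof -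
  have "(\<lambda>k. k \<in> K \<and> p \<in> R k) = (\<lambda>k. k \<in> K \<and> p \<in> S k)" for p using assms by auto
  moreover have "R (SOME k. k \<in> K \<and> p \<in> S k) = S (SOME k. k \<in> K \<and> p \<in> S k)" if "\<exists>k\<in>K. p \<in> S k" for p
    using someI_ex[of "\<lambda>k. k \<in> K \<and> p \<in> S k"] that assms by blast
  ultimately show ?thesis
    by (auto simp: concatenation_def Let_def fun_eq_iff assms)
qed

lemma cube_map_closed_box:
  assumes "open_box c \<noteq> {}"
  shows "cube_map (closed_box c) icube p = relative_point c p"
  using assms cube_map_cbox[of "fst c" "snd c" 0 1 p]
  by (simp add: open_box_nonempty closed_box_def relative_point_def)

text \<open>
  Each \<open>f k\<close> is extended by clamping its argument to the unit cube; as \<open>f k\<close> is \<open>x\<close> on the boundary, the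
  extension \<open>h k\<close> is \<open>x\<close> off the moving box. It is a composition of continuous maps, and the extensions
  are joined by \<open>continuous_map_join\<close>.
\<close>

lemma isotopy_imp_homotopy:
  fixes f :: "nat \<Rightarrow> real^'n \<Rightarrow> 'a"
  assumes K: "K \<noteq> {}" and F: "F \<subseteq> K" and f: "K_sequence X x K f"
    and iso: "isotopic_rel F (open_box (0, 1)) K c d"
    and R: "\<And>k. k \<in> K \<Longrightarrow> R k = closed_box (c k)" and S: "\<And>k. k \<in> K \<Longrightarrow> S k = closed_box (d k)"
  shows "\<exists>H. homotopy_rel_boundary X (concatenation x K R f) (concatenation x K S f) H \<and>
             H ` (icube \<times> {0..1}) \<subseteq> (\<Union>k\<in>K. f k ` icube) \<and> constant_homotopy_on (\<Union>k\<in>F. R k) H"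
proof -
  obtain g where "isotopy F (open_box (0, 1)) K c d g"
    using iso by (auto simp: isotopic_rel_def)
  note g = isotopyD[OF this]
  let ?Q = "icube \<times> {0..1} :: ((real^'n) \<times> real) set"
  define \<phi> where "\<phi> k z = (\<chi> i. max 0 (min 1 (relative_point (g k (snd z)) (fst z) $ i)))" for k z
  define h where "h k z = f k (\<phi> k z)" for k z
  define H where "H z = concatenation x K (\<lambda>k. closed_box (g k (snd z))) f (fst z)" for z
  have fO: "f k \<in> Omega X x" if "k \<in> K" for k using f that by (simp add: K_sequence_def)
  have ne: "open_box (g k t) \<noteq> {}" and inside: "open_box (g k t) \<subseteq> open_box (0, 1)"
    if "k \<in> K" "t \<in> {0..1}" for k t
    using arrangementD[OF g(4)[OF that(2)] that(1)] by auto
  have dom: "n_domain K (\<lambda>k. closed_box (g k t))" if t: "t \<in> {0..1}" for t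
    unfolding n_domain_def
  proof (intro conjI ballI)
    fix k assume k: "k \<in> K"
    have "closed_box (g k t) \<subseteq> icube"
      using closure_mono[OF inside[OF k t]] closure_open_box[OF ne[OF k t]] closure_open_box[of "(0, 1) :: 'n corners"]
      by (simp add: closed_box_def open_box_nonempty)
    then show "n_cube (closed_box (g k t))"
      using ne[OF k t] by (auto simp: n_cube_def open_box_nonempty closed_box_def)
  next
    show "disjoint_family_on (\<lambda>k. interior (closed_box (g k t))) K"
      using g(4)[OF t] by (simp add: arrangement_def)
  qed
  have \<phi>_unit: "\<phi> k z \<in> icube" for k z by (auto simp: \<phi>_def mem_box_cart)
  have h_out: "h k (p, t) = x" if k: "k \<in> K" and t: "t \<in> {0..1}" and p: "p \<notin> open_box (g k t)" for k p t
  proof -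
    have "relative_point (g k t) p \<notin> open_box (0, 1)" using relative_point_unit[OF ne[OF k t]] p by simp
    then obtain i where "relative_point (g k t) p $ i \<le> 0 \<or> relative_point (g k t) p $ i \<ge> 1"
      by (auto simp: mem_open_box not_less)
    then have "\<phi> k (p, t) $ i = 0 $ i \<or> \<phi> k (p, t) $ i = 1 $ i" by (auto simp: \<phi>_def)
    then have "\<phi> k (p, t) \<in> frontier icube" using \<phi>_unit by (auto simp: frontier_cbox_vec)
    then show ?thesis using fO[OF k] by (simp add: h_def Omega_def)
  qed
  have H_in: "H (p, t) = f k (relative_point (g k t) p)" "h k (p, t) = H (p, t)"
    if k: "k \<in> K" and t: "t \<in> {0..1}" and p: "p \<in> closed_box (g k t)" for k p t
  proof -
    show 1: "H (p, t) = f k (relative_point (g k t) p)"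
      using concatenation_on_cube[OF dom[OF t] ballI[OF fO] k p] cube_map_closed_box[OF ne[OF k t]]
      by (simp add: H_def)
    have "fst (g k t) $ i \<le> p $ i" "p $ i \<le> snd (g k t) $ i" "fst (g k t) $ i < snd (g k t) $ i" for i
      using p ne[OF k t] by (auto simp: mem_closed_box open_box_nonempty)
    then have "0 \<le> relative_point (g k t) p $ i" "relative_point (g k t) p $ i \<le> 1" for i
      by (auto simp: relative_point_def pos_divide_le_eq intro!: divide_nonneg_pos)
    then have "\<phi> k (p, t) = relative_point (g k t) p"
      by (simp add: \<phi>_def vec_eq_iff min_absorb2 max_absorb2)
    then show "h k (p, t) = H (p, t)" by (simp add: h_def 1)
  qed
  have sel: "\<exists>k\<in>K. H (p, t) = h k (p, t) \<and> (\<forall>j\<in>K - {k}. h j (p, t) = x)" if t: "t \<in> {0..1}" for p t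
  proof (cases "\<exists>k\<in>K. p \<in> closed_box (g k t)")
    case True
    then obtain k where k: "k \<in> K" "p \<in> closed_box (g k t)" by blast
    have "h j (p, t) = x" if j: "j \<in> K - {k}" for j
    proof (rule h_out)
      have "open_box (g j t) \<inter> closed_box (g k t) = {}"
        using j k t arrangement_disjoint[OF g(4)[OF t], of j k] ne
        by (intro open_disjoint_closed_box) auto
      then show "p \<notin> open_box (g j t)" using k(2) by blast
    qed (use j t in auto)
    then show ?thesis using k(1) H_in(2)[OF k(1) t k(2)] by (intro bexI[of _ k]) auto
  next
    case False
    obtain k where k: "k \<in> K" using K by blast
    have "h j (p, t) = x" if "j \<in> K" for j
      using False that interior_subset[of "closed_box (g j t)"] by (intro h_out t) auto
    moreover have "H (p, t) = x" using False by (auto simp: H_def concatenation_def)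
    ultimately show ?thesis using k by auto
  qed
  have prod: "prod_topology (top_of_set icube) (top_of_set {0..1}) = top_of_set ?Q"
    by (simp add: prod_topology_subtopology_eu)
  have "continuous_map (top_of_set ?Q) X H"
  proof (rule continuous_map_join[where h = h and K = K and x = x])
    fix k assume k: "k \<in> K"
    have gk: "continuous_on ?Q (\<lambda>z. g k (snd z))"
      using g(1)[OF k] unfolding path_def
      by (rule continuous_on_compose2) (auto intro!: continuous_intros)
    have "continuous_on ?Q (\<phi> k)"
      unfolding \<phi>_def relative_point_def
    proof (intro continuous_on_vec_lambda, simp only: vec_lambda_beta, intro continuous_intros gk ballI)
      fix i z assume "z \<in> ?Q"
      then have "snd z \<in> {0..1}" by auto
      then have "fst (g k (snd z)) $ i < snd (g k (snd z)) $ i" using ne[OF k] by (simp add: open_box_nonempty)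
      then show "snd (g k (snd z)) $ i - fst (g k (snd z)) $ i \<noteq> 0" by simp
    qed
    then have "continuous_map (top_of_set ?Q) (top_of_set icube) (\<phi> k)"
      using \<phi>_unit by auto
    then have "continuous_map (top_of_set ?Q) X (f k \<circ> \<phi> k)"
      using fO[OF k] by (intro continuous_map_compose) (auto simp: Omega_def)
    then show "continuous_map (top_of_set ?Q) X (h k)" by (simp add: h_def[abs_def] comp_def)
  next
    fix z assume "z \<in> topspace (top_of_set ?Q)"
    then show "\<exists>k\<in>K. H z = h k z \<and> (\<forall>j\<in>K - {k}. h j z = x)" using sel[of "snd z" "fst z"] by auto
  next
    fix U assume U: "openin X U" "x \<in> U"
    have "{k \<in> K. \<not> h k ` topspace (top_of_set ?Q) \<subseteq> U} \<subseteq> {k \<in> K. \<not> f k ` icube \<subseteq> U}"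
      using \<phi>_unit by (auto simp: h_def image_subset_iff)
    moreover have "finite {k \<in> K. \<not> f k ` icube \<subseteq> U}"
      using f U by (auto simp: K_sequence_def null_at_def)
    ultimately show "finite {k \<in> K. \<not> h k ` topspace (top_of_set ?Q) \<subseteq> U}" by (rule finite_subset)
  qed
  moreover have "H (p, 0) = concatenation x K R f p" "H (p, 1) = concatenation x K S f p" for p
    using concatenation_cong[of K "\<lambda>k. closed_box (g k 0)" R x f] concatenation_cong[of K "\<lambda>k. closed_box (g k 1)" S x f]
      g(2,3) R S by (simp_all add: H_def)
  moreover have "constant_homotopy_on (frontier icube) H"
  proof -
    have "H (p, t) = x" if p: "p \<in> frontier icube" and t: "t \<in> {0..1}" for p t
    proof -
      have "p \<notin> open_box (0, 1)" using p by (simp add: frontier_def open_box_def)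
      then show ?thesis using sel[OF t, of p] h_out[OF _ t] inside[OF _ t] by (metis subsetD)
    qed
    then show ?thesis by (simp add: constant_homotopy_on_def)
  qed
  moreover have "H ` ?Q \<subseteq> (\<Union>k\<in>K. f k ` icube)"
  proof
    fix y assume "y \<in> H ` ?Q"
    then obtain p t where "t \<in> {0..1}" "y = H (p, t)" by auto
    then obtain k where "k \<in> K" "y = h k (p, t)" using sel by metis
    then show "y \<in> (\<Union>k\<in>K. f k ` icube)"
      using \<phi>_unit by (intro UN_I[of k] image_eqI[of _ _ "\<phi> k (p, t)"]) (simp_all add: h_def)
  qed
  moreover have "constant_homotopy_on (\<Union>k\<in>F. R k) H"
    unfolding constant_homotopy_on_def
  proof (intro ballI)
    fix p and t :: real assume "p \<in> (\<Union>k\<in>F. R k)" and t: "t \<in> {0..1}"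
    then obtain k where k: "k \<in> F" "k \<in> K" "p \<in> closed_box (c k)" using R F by auto
    then show "H (p, t) = H (p, 0)"
      using H_in(1)[of k t p] H_in(1)[of k 0 p] g(5)[OF k(1,2), of t] g(5)[OF k(1,2), of 0] t by simp
  qed
  ultimately show ?thesis
    unfolding homotopy_rel_boundary_def prod by (intro exI[of _ H]) simp
qed

section \<open>Concatenations over two domains\<close>

definition corners_of :: "(real^'n) set \<Rightarrow> 'n::finite corners" where
  "corners_of A = (interval_lowerbound A, interval_upperbound A)"

lemma n_cube_corners:
  assumes "n_cube A"
  shows "closed_box (corners_of A) = A" "open_box (corners_of A) \<noteq> {}"
    "open_box (corners_of A) \<subseteq> open_box (0, 1)"
proof -
  obtain a b where ab: "\<And>i. a $ i < b $ i" "A = cbox a b" and A: "A \<subseteq> icube"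
    using assms by (auto simp: n_cube_def)
  have "cbox a b \<noteq> {}" using ab(1) by (auto simp: interval_ne_empty_cart less_imp_le)
  then have "corners_of A = (a, b)"
    using ab(2) by (simp add: corners_of_def interval_upperbound interval_lowerbound box_ne_empty)
  then show "closed_box (corners_of A) = A" "open_box (corners_of A) \<noteq> {}"
    using ab by (simp_all add: closed_box_def open_box_nonempty)
  then show "open_box (corners_of A) \<subseteq> open_box (0, 1)"
    using interior_mono[OF A] interior_closed_box[of "corners_of A"] by (simp add: open_box_def)
qed

lemma n_domain_arrangement:
  assumes "n_domain K R"
  shows "arrangement (open_box (0, 1)) K (\<lambda>k. corners_of (R k))"
proof (rule arrangementI)
  have cube: "n_cube (R k)" if "k \<in> K" for k using assms that by (simp add: n_domain_def)
  have int: "open_box (corners_of (R k)) = interior (R k)" if "k \<in> K" for k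
    using n_cube_corners(1)[OF cube[OF that]] interior_closed_box by metis
  fix k l assume "k \<in> K" "l \<in> K" "k \<noteq> l"
  then show "open_box (corners_of (R k)) \<inter> open_box (corners_of (R l)) = {}"
    using assms int by (simp add: n_domain_def disjoint_family_on_def)
next
  fix k assume "k \<in> K"
  then have "n_cube (R k)" using assms by (simp add: n_domain_def)
  from n_cube_corners(2,3)[OF this]
  show "open_box (corners_of (R k)) \<noteq> {}" "open_box (corners_of (R k)) \<subseteq> open_box (0, 1)" .
qed

theorem theorem1p1:
  fixes X :: "'a topology" and x :: 'a
    and K :: "nat set"
    and R S :: "nat \<Rightarrow> (real^'n) set"
    and f :: "nat \<Rightarrow> real^'n \<Rightarrow> 'a"
  assumes "CARD('n) \<ge> 2"
    and "path_connected_space X" and "x \<in> topspace X"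
    and "K \<noteq> {}"
    and "n_domain K R" and "n_domain K S"
    and "K_sequence X x K f"
  shows "(\<exists>H. homotopy_rel_boundary X (concatenation x K R f) (concatenation x K S f) H \<and>
              H ` (icube \<times> {0..1}) \<subseteq> (\<Union>k\<in>K. f k ` icube)) \<and>
         (\<forall>F. finite F \<and> F \<subseteq> K \<and> (\<forall>k\<in>F. R k = S k) \<and>
              path_connected (icube - (\<Union>k\<in>F. R k)) \<longrightarrow>
            (\<exists>H. homotopy_rel_boundary X (concatenation x K R f) (concatenation x K S f) H \<and>
                 H ` (icube \<times> {0..1}) \<subseteq> (\<Union>k\<in>K. f k ` icube) \<and>
                 constant_homotopy_on (\<Union>k\<in>F. R k) H))"
proof -
  have box: "A k = closed_box (corners_of (A k))" if "n_domain K A" "k \<in> K" for A :: "nat \<Rightarrow> (real^'n) set" and k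
    using that n_cube_corners(1)[of "A k"] by (simp add: n_domain_def)
  have rel: "\<exists>H. homotopy_rel_boundary X (concatenation x K R f) (concatenation x K S f) H \<and>
                 H ` (icube \<times> {0..1}) \<subseteq> (\<Union>k\<in>K. f k ` icube) \<and>
                 constant_homotopy_on (\<Union>k\<in>F. R k) H"
    if F: "finite F" "F \<subseteq> K" "\<And>k. k \<in> F \<Longrightarrow> R k = S k" and pc: "path_connected (icube - (\<Union>k\<in>F. R k))" for F
  proof -
    have UN: "(\<Union>k\<in>F. R k) = (\<Union>k\<in>F. closed_box (corners_of (R k)))"
      using box[OF assms(5)] F(2) by (intro SUP_cong) auto
    have "closed (\<Union>k\<in>F. R k)" unfolding UN closed_box_def using F(1) by (intro closed_UN) auto
    then have "path_connected (interior icube - (\<Union>k\<in>F. R k))"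
      using pc by (intro path_connected_interior_diff) auto
    then have "connected (open_box (0, 1) - (\<Union>k\<in>F. closed_box (corners_of (R k))))"
      unfolding UN by (simp add: open_box_def path_connected_imp_connected)
    then have "isotopic_rel F (open_box (0, 1)) K (\<lambda>k. corners_of (R k)) (\<lambda>k. corners_of (S k))"
      using F(3) n_domain_arrangement[OF assms(5)] n_domain_arrangement[OF assms(6)]
      by (intro arrangements_isotopic_rel[OF assms(1) F(1,2)]) auto
    then show ?thesis
      by (rule isotopy_imp_homotopy[OF assms(4) F(2) assms(7)]) (use box assms(5,6) in auto)
  qed
  have "path_connected (icube :: (real^'n) set)" by (simp add: convex_imp_path_connected)
  then have "\<exists>H. homotopy_rel_boundary X (concatenation x K R f) (concatenation x K S f) H \<and>
              H ` (icube \<times> {0..1}) \<subseteq> (\<Union>k\<in>K. f k ` icube)"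
    using rel[of "{}"] by auto
  then show ?thesis
    by (intro conjI allI impI rel) (simp_all only:)
qed

end
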